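(* For all $h\in\mathcal{Q}\setminus\{0\}$, the GoldenNugget heap of size $h$ has value $\mathrm{val}(h)=\delta(h)$, where $\delta(h)$ is the unique dyadic rational in $[1/2,1]$ with $\xi(\delta(h))=h$.
   Context: Let $\phi=\frac{1+\sqrt5}{2}$, and for integers $n\ge 0$ let $A(n)=\lfloor n\phi\rfloor$, $B(n)=\lfloor n\phi^2\rfloor$. Fibonacci numbers: $F_0=0$, $F_1=F_2=1$, $F_n=F_{n-1}+F_{n-2}$. $\mathcal{Q}=\{B(B(n))+1: n\ge 1\}\cup\{F_{2n+3}-2: n\ge 0\}$. GoldenNugget is the normal-play partizan game played on a heap of $h\ge 0$ counters: Left's options are the heaps $h-a$ with $a\in\{A(i): i\ge 1\}$, $a\le h$; Right's options are the heaps $h-b$ with $b\in\{B(i): i\ge 1\}$, $b\le h$; a player who cannot move loses. $\mathrm{val}(h)$ is its value in the usual sense of combinatorial game theory (its game up to equality), and dyadic rationals are identified with games in the usual way. The map $\xi$: for a dyadic rational $d\in[1/2,1]$ with finite binary representation $d=d_0.d_1d_2\ldots d_k$, put $\xi(d)=\sum_{i} d_iF_{e(i)}$, where $e(0)=2$, $e(1)=4$, and for $i\ge 2$, $e(i)=e(i-1)$ if $d_{i-2}d_{i-1}=01$, and $e(i)=e(i-1)+2$ otherwise. For every $h\in\mathcal{Q}\setminus\{0\}$ there is a unique dyadic rational in $[1/2,1]$ mapped to $h$ by $\xi$; it is denoted $\delta(h)$. *)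

theory Defs
  imports Complex_Main "HOL-Library.FSet" "HOL-Number_Theory.Fib"
begin

section \<open>Short partizan games under normal play\<close>

datatype game = Game (left_opts: "game fset") (right_opts: "game fset")

lemma size_left_opt: "G |\<in>| left_opts H \<Longrightarrow> size G < size H"
  by (cases H) (auto simp: size_fset_overloaded_simps less_Suc_eq_le
      intro!: trans_le_add1 order.trans[OF _ member_le_sum[where f = "\<lambda>x. Suc (size x)"]])

lemma size_right_opt: "G |\<in>| right_opts H \<Longrightarrow> size G < size H"
  by (cases H) (auto simp: size_fset_overloaded_simps less_Suc_eq_le
      intro!: trans_le_add2 order.trans[OF _ member_le_sum[where f = "\<lambda>x. Suc (size x)"]])

text \<open>Conway's order: \<open>G \<le> H\<close> iff no left option of \<open>G\<close> is \<open>\<ge> H\<close> and no right option of \<open>H\<close>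
  is \<open>\<le> G\<close>. The convention that a player who cannot move loses is built into the base case:
  the game without options is \<open>\<le> H\<close> iff Left wins \<open>H\<close> moving second.\<close>

function game_le :: "game \<Rightarrow> game \<Rightarrow> bool" where
  "game_le G H \<longleftrightarrow>
     (\<forall>G'. G' |\<in>| left_opts G \<longrightarrow> \<not> game_le H G') \<and>
     (\<forall>H'. H' |\<in>| right_opts H \<longrightarrow> \<not> game_le H' G)"
  by auto
termination
  by (relation "measure (\<lambda>(G, H). size G + size H)")
     (auto dest: size_left_opt size_right_opt)

declare game_le.simps [simp del]

definition game_eq :: "game \<Rightarrow> game \<Rightarrow> bool" where
  "game_eq G H \<longleftrightarrow> game_le G H \<and> game_le H G"

primrec game_neg :: "game \<Rightarrow> game" where
  "game_neg (Game L R) = Game (game_neg |`| R) (game_neg |`| L)"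

section \<open>Dyadic rationals as games\<close>

primrec nat_game :: "nat \<Rightarrow> game" where
  "nat_game 0 = Game {||} {||}"
| "nat_game (Suc n) = Game {|nat_game n|} {||}"

definition int_game :: "int \<Rightarrow> game" where
  "int_game m = (if m \<ge> 0 then nat_game (nat m) else game_neg (nat_game (nat (- m))))"

text \<open>The game of \<open>m / 2 ^ k\<close>, in canonical form.\<close>

fun dyadic_game :: "int \<Rightarrow> nat \<Rightarrow> game" where
  "dyadic_game m 0 = int_game m"
| "dyadic_game m (Suc k) =
     (if even m then dyadic_game (m div 2) k
      else Game {|dyadic_game ((m - 1) div 2) k|} {|dyadic_game ((m + 1) div 2) k|})"

definition dyadic :: "rat \<Rightarrow> bool" where
  "dyadic d \<longleftrightarrow> (\<exists>(m::int) (k::nat). d = of_int m / 2 ^ k)"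

text \<open>Meaningful for dyadic \<open>d\<close> only.\<close>

definition number_game :: "rat \<Rightarrow> game" where
  "number_game d = (let k = (LEAST k. d * 2 ^ k \<in> \<int>) in dyadic_game \<lfloor>d * 2 ^ k\<rfloor> k)"

section \<open>GoldenNugget\<close>

definition phi :: real where
  "phi = (1 + sqrt 5) / 2"

definition A :: "nat \<Rightarrow> nat" where
  "A n = nat \<lfloor>real n * phi\<rfloor>"

definition B :: "nat \<Rightarrow> nat" where
  "B n = nat \<lfloor>real n * phi\<^sup>2\<rfloor>"

definition Q :: "nat set" where
  "Q = {B (B n) + 1 | n. n \<ge> 1} \<union> {fib (2 * n + 3) - 2 | n. True}"

text \<open>Restricting to positive moves \<open>a\<close> only serves termination: \<open>A i\<close> and \<open>B i\<close> are positive
  for \<open>i \<ge> 1\<close>.\<close>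

function golden_nugget :: "nat \<Rightarrow> game" where
  "golden_nugget h =
     Game ((\<lambda>a. golden_nugget (h - a)) |`| ffilter (\<lambda>a. a \<in> A ` {1..}) (fset_of_list [1..<Suc h]))
          ((\<lambda>b. golden_nugget (h - b)) |`| ffilter (\<lambda>b. b \<in> B ` {1..}) (fset_of_list [1..<Suc h]))"
  by auto
termination
  by (relation "measure id") (auto simp: fset_of_list_elem)

declare golden_nugget.simps [simp del]

section \<open>The map \<open>\<xi>\<close>\<close>

text \<open>Digit \<open>d\<^sub>i\<close> in \<open>d = d\<^sub>0.d\<^sub>1d\<^sub>2\<dots>\<close> for \<open>0 \<le> d < 2\<close>; for dyadic \<open>d\<close> this is the terminating
  expansion, padded with zeros.\<close>

definition digit :: "rat \<Rightarrow> nat \<Rightarrow> nat" where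
  "digit d i = nat (\<lfloor>d * 2 ^ i\<rfloor> mod 2)"

fun xi_index :: "rat \<Rightarrow> nat \<Rightarrow> nat" where
  "xi_index d 0 = 2"
| "xi_index d (Suc 0) = 4"
| "xi_index d (Suc (Suc i)) =
     (if digit d i = 0 \<and> digit d (Suc i) = 1 then xi_index d (Suc i) else xi_index d (Suc i) + 2)"

text \<open>The index set is finite for dyadic \<open>d\<close>.\<close>

definition xi :: "rat \<Rightarrow> nat" where
  "xi d = (\<Sum>i | digit d i \<noteq> 0. digit d i * fib (xi_index d i))"

definition is_delta :: "nat \<Rightarrow> rat \<Rightarrow> bool" where
  "is_delta h d \<longleftrightarrow> dyadic d \<and> 1 / 2 \<le> d \<and> d \<le> 1 \<and> xi d = h"

definition delta :: "nat \<Rightarrow> rat" where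
  "delta h = (THE d. is_delta h d)"

end

theory Submission
  imports Defs
begin

text \<open>
  Everything is read off the rotation \<open>rot n\<close>, the fractional part of \<open>- n \<phi>\<close>. With
  \<open>\<tau> = 1 / \<phi>\<close>, a positive \<open>n\<close> is a Left move iff \<open>rot n < \<tau>\<close> and a Right move iff
  \<open>rot n > \<tau>\<close>, so between two heaps of \<open>Q\<close> it is Left who can move to the one of smaller
  rotation and Right who can move to the one of larger rotation. Walking down the dyadic tree,
  \<open>\<xi>\<close> places at the midpoint of two neighbouring dyadics a heap larger than both of theirs and
  with rotation strictly in between; hence \<open>\<delta>\<close> is increasing in \<open>rot\<close> and the options of
  the canonical form of \<open>\<delta> h\<close> are met by moves from \<open>h\<close>. A move out of \<open>Q\<close> is always
  answered by a move back into \<open>Q \<union> {1}\<close> that does not overshoot, because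
  \<open>n \<phi>\<close> comes within \<open>\<tau> ^ m\<close> of an integer, on the side of \<open>fib m * \<phi>\<close>, only for
  \<open>n > fib m\<close>.
\<close>

section \<open>Golden ratio and rotations\<close>

lemma phi_gt: "phi > 8/5" and phi_lt: "phi < 13/8"
proof -
  have "11/5 < sqrt 5" "sqrt 5 < 9/4"
    by (rule real_less_rsqrt real_less_lsqrt; simp add: power2_eq_square)+
  then show "phi > 8/5" "phi < 13/8"
    by (simp_all add: phi_def)
qed

lemma phi_sq: "phi\<^sup>2 = phi + 1"
  unfolding phi_def by (simp add: power2_eq_square field_simps)

definition tau :: real where
  "tau = phi - 1"

lemma phi_tau: "phi = 1 + tau"
  by (simp add: tau_def)

lemma tau_bounds: "3/5 < tau" "tau < 5/8"
  using phi_gt phi_lt by (auto simp: tau_def)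

lemma tau_pos [simp]: "0 < tau"
  using tau_bounds by simp

lemma tau_neq_0 [simp]: "tau \<noteq> 0"
  using tau_pos by linarith

lemma tau_sq: "tau\<^sup>2 = 1 - tau"
  using phi_sq by (simp add: tau_def power2_eq_square algebra_simps)

lemma tau_mult: "tau * tau = 1 - tau" "tau * (tau * x) = x - tau * x"
proof -
  show eq: "tau * tau = 1 - tau"
    using tau_sq by (simp add: power2_eq_square)
  show "tau * (tau * x) = x - tau * x"
    unfolding mult.assoc[symmetric] eq by (simp add: algebra_simps)
qed

lemma phi_mult: "phi * phi = phi + 1" "phi * (phi * x) = phi * x + x"
proof -
  show eq: "phi * phi = phi + 1"
    using phi_sq by (simp add: power2_eq_square)
  show "phi * (phi * x) = phi * x + x"
    unfolding mult.assoc[symmetric] eq by (simp add: algebra_simps)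
qed

lemma tau_cube: "tau ^ 3 = 2 * tau - 1"
  by (simp add: power3_eq_cube tau_mult algebra_simps)

lemma tau_four: "tau ^ 4 = 2 - 3 * tau"
  by (simp add: power_numeral_reduce tau_mult algebra_simps)

lemma tau_power_rec: "tau ^ (n + 2) = tau ^ n - tau ^ (n + 1)"
  by (simp add: tau_mult)

lemma tau_power_less: "m < n \<Longrightarrow> tau ^ n < tau ^ m"
  using tau_bounds by (intro power_strict_decreasing) auto

lemma tau_power_le: "m \<le> n \<Longrightarrow> tau ^ n \<le> tau ^ m"
  using tau_bounds by (intro power_decreasing) auto

text \<open>A reduced fraction m / n equal to phi satisfies m^2 = n (m + n), so coprimality forces n
  = 1, and no integer lies between 8/5 and 13/8.\<close>

lemma phi_irrational:
  fixes i j :: int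
  assumes "of_int i * phi = of_int j"
  shows "i = 0"
proof (rule ccontr)
  assume "i \<noteq> 0"
  then have "phi = of_int j / of_int i"
    using assms by (simp add: field_simps)
  then have "phi \<in> \<rat>"
    by (metis Rats_divide Rats_of_int)
  then obtain m n :: nat where mn: "n \<noteq> 0" "\<bar>phi\<bar> = real m / real n" "coprime m n"
    by (rule Rats_abs_nat_div_natE)
  then have "phi * real n = real m"
    using phi_gt by (simp add: field_simps)
  then have "real (m * m) = real (n * (m + n))"
    by (simp add: phi_mult ring_distribs flip: \<open>phi * real n = real m\<close>) (simp add: algebra_simps phi_mult)
  then have "n dvd m * m"
    by (metis dvd_triv_left of_nat_eq_iff)
  then have "n = 1"
    using mn(3) coprime_common_divisor[of "m * m" n n] by simp
  then have "8/5 < real m" "real m < 13/8"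
    using mn(2) phi_gt phi_lt by auto
  then have "1 < m" "m < 2"
    by linarith+
  then show False
    by simp
qed

section \<open>Fibonacci numbers and one-sided approximation of phi\<close>

lemma fib_phi: "real (fib n) * phi = real (fib (Suc n)) - (- tau) ^ n"
proof (induction n rule: fib.induct)
  case (3 n)
  have "(- tau) ^ Suc (Suc n) = (- tau) ^ n + (- tau) ^ Suc n"
    by (simp add: tau_mult)
  with 3 show ?case
    by (simp add: algebra_simps)
qed (auto simp: tau_def)

lemma fib_binet: "(2 * phi - 1) * real (fib n) = phi ^ n - (- tau) ^ n"
proof (induction n rule: fib.induct)
  case (3 n)
  have "(- tau) ^ Suc (Suc n) = (- tau) ^ n + (- tau) ^ Suc n"
    by (simp add: tau_mult)
  moreover have "phi ^ Suc (Suc n) = phi ^ n + phi ^ Suc n"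
    by (simp add: phi_mult)
  ultimately show ?case
    using 3 by (simp add: algebra_simps)
qed (auto simp: tau_def)

lemma phi_inverse_power: "1 / tau ^ n = phi ^ n"
proof -
  have "phi = 1 / tau"
    by (simp add: phi_tau nonzero_eq_divide_eq tau_mult distrib_right)
  then show ?thesis
    by (metis power_one_over)
qed

text \<open>The norm of \<open>n\<phi> - j\<close> in the ring of integers of the golden field is a nonzero integer.\<close>

lemma golden_norm_ge_1:
  fixes n :: nat and j :: int
  assumes "n > 0"
  defines "s \<equiv> real n * phi - of_int j"
  shows "\<bar>s * (real n * (2 * phi - 1) - s)\<bar> \<ge> 1"
proof -
  define N :: int where "N = int n * int n + int n * j - j * j"
  have eq: "s * (real n * (2 * phi - 1) - s) = of_int N"
    unfolding s_def N_def by (simp add: phi_mult algebra_simps)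
  have "s \<noteq> 0"
    using phi_irrational[of "int n" j] assms by auto
  moreover have "real n * (2 * phi - 1) - s \<noteq> 0"
    using phi_irrational[of "int n" "int n - j"] assms by (auto simp: algebra_simps)
  ultimately have "N \<noteq> 0"
    using eq by (metis mult_eq_0_iff of_int_0)
  then have "\<bar>N\<bar> \<ge> 1" by simp
  then show ?thesis
    unfolding eq by linarith
qed

text \<open>Here \<open>2 * phi - 1\<close> is the square root of 5. For the distance
  \<open>s\<close> the norm bound reads \<open>1 / s + s \<le> n * sqrt 5\<close>. Since
  \<open>1 / x + x\<close> decreases on (0, 1], its value at the larger \<open>tau ^ m\<close> is
  smaller, and by Binet's formula for odd \<open>m\<close> that value is
  \<open>fib m * sqrt 5\<close>.\<close>

lemma approx_above:
  fixes n :: nat and j :: int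
  assumes "n > 0" "odd m" "0 < real n * phi - of_int j" "real n * phi - of_int j < tau ^ m"
  shows "fib m < n"
proof -
  define s where "s = real n * phi - of_int j"
  define t where "t = tau ^ m"
  have t: "0 < s" "s < t" "t \<le> 1"
    using assms tau_power_le[of 0 m] by (auto simp: s_def t_def)
  have "s < real n * (2 * phi - 1)"
  proof -
    have "real n * 1 \<le> real n * (2 * phi - 1)"
      using phi_gt by (intro mult_left_mono) auto
    moreover have "1 \<le> real n"
      using assms(1) by simp
    ultimately show ?thesis
      using t by linarith
  qed
  then have "1 \<le> s * (real n * (2 * phi - 1) - s)"
    using golden_norm_ge_1[OF assms(1), of j] t by (simp add: s_def abs_mult)
  then have "1 / s + s \<le> real n * (2 * phi - 1)"
    using t by (simp add: field_simps)
  moreover have "1 / t + t < 1 / s + s"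
  proof -
    have "s * t < 1 * 1"
      using t by (intro mult_less_le_imp_less) auto
    then have "0 < (t - s) * (1 - s * t) / (s * t)"
      using t by auto
    also have "\<dots> = 1 / s + s - (1 / t + t)"
      using t by (simp add: field_simps)
    finally show ?thesis by simp
  qed
  moreover have "1 / t + t = (2 * phi - 1) * real (fib m)"
    using fib_binet[of m] phi_inverse_power[of m] assms(2) by (simp add: t_def)
  ultimately have "(2 * phi - 1) * real (fib m) < (2 * phi - 1) * real n"
    by (simp add: mult.commute)
  then show ?thesis
    using phi_gt by (simp add: mult_less_cancel_left)
qed

text \<open>With \<open>s\<close> on the other side of the integer the decreasing function is
  \<open>1 / x - x\<close>, whose value at \<open>tau ^ m\<close> is \<open>fib m * sqrt 5\<close>
  for even \<open>m\<close>.\<close>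

lemma approx_below:
  fixes n :: nat and j :: int
  assumes "n > 0" "even m" "0 < of_int j - real n * phi" "of_int j - real n * phi < tau ^ m"
  shows "fib m < n"
proof -
  define s where "s = of_int j - real n * phi"
  define t where "t = tau ^ m"
  have t: "0 < s" "s < t"
    using assms by (auto simp: s_def t_def)
  have "0 < real n * (2 * phi - 1) + s"
    using t phi_gt assms(1) by (intro add_pos_pos mult_pos_pos) auto
  moreover have "\<bar>- s * (real n * (2 * phi - 1) + s)\<bar> \<ge> 1"
    using golden_norm_ge_1[OF assms(1), of j] by (simp add: s_def algebra_simps)
  ultimately have "1 \<le> s * (real n * (2 * phi - 1) + s)"
    using t by (simp add: abs_mult)
  then have "1 / s - s \<le> real n * (2 * phi - 1)"
    using t by (simp add: field_simps)
  moreover have "1 / t < 1 / s"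
    using t by (simp add: field_simps)
  moreover have "1 / t - t = (2 * phi - 1) * real (fib m)"
    using fib_binet[of m] phi_inverse_power[of m] assms(2) by (simp add: t_def)
  ultimately have "(2 * phi - 1) * real (fib m) < (2 * phi - 1) * real n"
    using t by (simp add: mult.commute)
  then show ?thesis
    using phi_gt by (simp add: mult_less_cancel_left)
qed

section \<open>The rotation of a heap\<close>

definition rot :: "nat \<Rightarrow> real" where
  "rot n = frac (- (real n * phi))"

lemma rot_bounds: "0 \<le> rot n" "rot n < 1"
  by (auto simp: rot_def frac_lt_1)

lemma rot_obtain:
  obtains j :: int where "rot n = of_int j - real n * phi"
proof
  show "rot n = of_int (- \<lfloor>- (real n * phi)\<rfloor>) - real n * phi"
    by (simp add: rot_def frac_def)
qed

lemma rot_eqI: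
  assumes "0 \<le> x" "x < 1" "x = of_int j - real n * phi"
  shows "rot n = x"
proof -
  have "x - - (real n * phi) = of_int j"
    using assms(3) by simp
  then have "- (real n * phi) - x \<in> \<int>"
    by (metis Ints_minus Ints_of_int minus_diff_eq)
  then show ?thesis
    using assms by (simp add: rot_def frac_unique_iff)
qed

lemma rot_0 [simp]: "rot 0 = 0"
  by (simp add: rot_def)

lemma rot_1: "rot 1 = 1 - tau"
  using tau_bounds by (intro rot_eqI[of _ 2]) (auto simp: phi_tau)

lemma rot_2: "rot 2 = 2 - 2 * tau"
  using tau_bounds by (intro rot_eqI[of _ 4]) (auto simp: phi_tau)

lemma rot_3: "rot 3 = 2 - 3 * tau"
  using tau_bounds by (intro rot_eqI[of _ 5]) (auto simp: phi_tau)

text \<open>By irrationality, \<open>rot\<close> would only attain \<open>a \<tau> + b\<close> at the index \<open>- a\<close>.\<close>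

lemma rot_eq_imp:
  fixes a b :: int
  assumes "rot n = of_int a * tau + of_int b"
  shows "int n = - a"
proof -
  obtain j where j: "rot n = of_int j - real n * phi"
    by (rule rot_obtain)
  have "of_int (int n + a) * phi = of_int (j + a - b)"
    using assms j by (simp add: phi_tau algebra_simps)
  from phi_irrational[OF this] show ?thesis by simp
qed

lemma rot_inj: "rot n = rot k \<Longrightarrow> n = k"
proof -
  assume eq: "rot n = rot k"
  obtain i where i: "rot n = of_int i - real n * phi"
    by (rule rot_obtain)
  obtain j where j: "rot k = of_int j - real k * phi"
    by (rule rot_obtain)
  have "of_int (int n - int k) * phi = of_int (i - j)"
    using eq i j by (simp add: algebra_simps)
  from phi_irrational[OF this] show ?thesis by simp
qed

text \<open>These are the end points of the intervals that describe moves and members of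
  \<open>Q\<close>, so a failed strict comparison with one of them can be turned into the opposite
  strict one. The values \<open>tau\<close> and \<open>tau ^ 3 = 2 * tau - 1\<close> would need the
  indices -1 and -2.\<close>

lemma rot_neq: "n > 0 \<Longrightarrow> rot n \<noteq> 0" "rot n \<noteq> tau" "rot n \<noteq> tau ^ 3" "rot n = 1 - tau \<longleftrightarrow> n = 1"
  using rot_inj[of n 0] rot_eq_imp[of n 1 0] rot_eq_imp[of n 2 "-1"] rot_eq_imp[of n "-1" 1] rot_1
  by (auto simp: tau_cube)

lemma rot_diff:
  assumes "k \<le> h"
  shows "rot (h - k) = (if rot k \<le> rot h then rot h - rot k else rot h - rot k + 1)"
proof -
  obtain i where i: "rot h = of_int i - real h * phi"
    by (rule rot_obtain)
  obtain j where j: "rot k = of_int j - real k * phi"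
    by (rule rot_obtain)
  have hk: "real (h - k) = real h - real k"
    using assms by simp
  show ?thesis
  proof (cases "rot k \<le> rot h")
    case True
    then show ?thesis
      using rot_bounds[of h] rot_bounds[of k] i j
      by (subst rot_eqI[of "rot h - rot k" "i - j"]) (simp_all add: hk left_diff_distrib)
  next
    case False
    then show ?thesis
      using rot_bounds[of h] rot_bounds[of k] i j
      by (subst rot_eqI[of "rot h - rot k + 1" "i - j + 1"]) (simp_all add: hk left_diff_distrib)
  qed
qed

text \<open>The difference \<open>h - p\<close> has rotation \<open>rot h - rot p\<close>, so its
  multiple of phi lies less than \<open>tau ^ m\<close> below an integer.\<close>

lemma rot_add_approx_below:
  assumes "h > p" "even m" "rot p < rot h" "rot h < rot p + tau ^ m"
  shows "p + fib m < h"
proof -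
  obtain j where "rot (h - p) = of_int j - real (h - p) * phi"
    by (rule rot_obtain)
  moreover have "rot (h - p) = rot h - rot p"
    using assms rot_diff[of p h] by auto
  ultimately have "fib m < h - p"
    using assms by (intro approx_below[of _ _ j]) auto
  then show ?thesis by simp
qed

lemma rot_add_approx_above:
  assumes "h > p" "odd m" "rot h < rot p" "rot p < rot h + tau ^ m"
  shows "p + fib m < h"
proof -
  obtain j where "rot (h - p) = of_int j - real (h - p) * phi"
    by (rule rot_obtain)
  moreover have "rot (h - p) = rot h - rot p + 1"
    using assms rot_diff[of p h] by auto
  ultimately have "fib m < h - p"
    \<comment> \<open>The rotation of \<open>h - p\<close> has wrapped around, so the integer just
      below its multiple of phi is \<open>j - 1\<close>, at distance
      \<open>rot p - rot h\<close>.\<close>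
    using assms by (intro approx_above[of _ _ "j - 1"]) auto
  then show ?thesis by simp
qed

text \<open>For even \<open>m\<close>, \<open>fib m * phi\<close> falls short of an integer by
  \<open>tau ^ m\<close>, which turns the rotation forward by that amount.\<close>

lemma rot_add_fib_even:
  assumes "even m" "rot p + tau ^ m < 1"
  shows "rot (p + fib m) = rot p + tau ^ m"
proof -
  obtain j where j: "rot p = of_int j - real p * phi"
    by (rule rot_obtain)
  show ?thesis
    using rot_bounds[of p] assms fib_phi[of m] j
    by (intro rot_eqI[of _ "j + int (fib (Suc m))"]) (auto simp: algebra_simps add_nonneg_nonneg less_imp_le)
qed

text \<open>Subtracting 2 adds \<open>2 * phi = 3 + tau ^ 3\<close>, hence \<open>tau ^ 3\<close>
  modulo 1, and for odd \<open>m\<close> adding \<open>fib m\<close> turns back by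
  \<open>tau ^ m\<close>. So the exceptional heaps of \<open>Q\<close> climb towards
  \<open>tau ^ 3\<close> from below.\<close>

lemma rot_fib_minus_2:
  assumes "odd m" "m \<ge> 3"
  shows "rot (fib m - 2) = tau ^ 3 - tau ^ m" and "fib m \<ge> 2"
proof -
  have "fib 3 \<le> fib m"
    using assms by (intro fib_mono)
  then show ge: "fib m \<ge> 2"
    by (simp add: numeral_eq_Suc)
  have fm: "real (fib m - 2) = real (fib m) - 2"
    using ge by simp
  have "tau ^ m \<le> tau ^ 3" "0 < tau ^ m" "tau ^ 3 < 1" "0 < tau ^ 3"
    using assms tau_power_le[of 3 m] tau_power_less[of 0 3] by auto
  then show "rot (fib m - 2) = tau ^ 3 - tau ^ m"
    using fib_phi[of m] assms(1)
    by (intro rot_eqI[of _ "int (fib (Suc m)) - 3"])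
       (use \<open>0 < tau ^ m\<close> in \<open>linarith | simp add: fm left_diff_distrib, simp add: phi_tau tau_cube\<close>)+
qed

text \<open>\<open>B\<close> contracts the distance of the rotation from 1 by the factor
  \<open>tau ^ 2\<close>. With \<open>i\<close> the ceiling of \<open>j * phi\<close>, the value
  \<open>B j\<close> is \<open>j + i - 1\<close>.\<close>

lemma rot_B:
  assumes "j > 0"
  shows "rot (B j) = 1 - (1 - rot j) * tau\<^sup>2" "0 < B j"
proof -
  obtain i where i: "rot j = of_int i - real j * phi"
    by (rule rot_obtain)
  have pos: "0 < rot j"
    using rot_neq(1)[OF assms] rot_bounds[of j] by simp
  have "real j * phi\<^sup>2 = real j + of_int i - rot j"
    using i phi_sq by (simp add: algebra_simps)
  then have fl: "\<lfloor>real j * phi\<^sup>2\<rfloor> = int j + i - 1"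
    using pos rot_bounds[of j] by (intro floor_unique) auto
  have "1 * 1 < real j * phi\<^sup>2"
    using assms phi_gt phi_sq by (intro mult_le_less_imp_less) auto
  then have "1 \<le> \<lfloor>real j * phi\<^sup>2\<rfloor>"
    by linarith
  then show "0 < B j"
    by (simp add: B_def)
  have Bj: "real (B j) = real j + of_int i - 1"
    using \<open>1 \<le> _\<close> fl by (simp add: B_def)
  have "(1 - rot j) * tau\<^sup>2 \<le> 1 * 1"
    using rot_bounds[of j] tau_sq tau_bounds by (intro mult_mono) auto
  moreover have "0 < (1 - rot j) * tau\<^sup>2"
    using rot_bounds[of j] by (intro mult_pos_pos) auto
  moreover have "1 - (1 - rot j) * tau\<^sup>2 = of_int (i + int (B j)) - real (B j) * phi"
  proof -
    have "real j * phi + (real j * phi) * tau = real j * phi\<^sup>2"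
      by (simp add: phi_tau power2_eq_square algebra_simps)
    then have "real j * phi * tau = real j"
      using phi_sq by (simp add: algebra_simps)
    then have "rot j * tau = of_int i * tau - real j"
      unfolding i by (simp add: left_diff_distrib)
    moreover have "real (B j) * phi = real (B j) + of_int i * tau + real j * tau - tau"
      by (simp add: Bj phi_tau algebra_simps)
    moreover have "1 - (1 - rot j) * tau\<^sup>2 = rot j + tau - rot j * tau"
      by (simp add: tau_sq algebra_simps)
    moreover have "rot j = of_int i - real j - real j * tau"
      using i by (simp add: phi_tau algebra_simps)
    ultimately show ?thesis
      using Bj by simp
  qed
  ultimately show "rot (B j) = 1 - (1 - rot j) * tau\<^sup>2"
    by (intro rot_eqI[of _ "i + int (B j)"]) auto
qed

lemma B_image_iff: "n \<in> B ` {1..} \<longleftrightarrow> n > 0 \<and> tau < rot n"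
proof (intro iffI conjI)
  assume "n \<in> B ` {1..}"
  then obtain j where j: "j > 0" "n = B j" by (auto simp: Suc_le_eq)
  have "(1 - rot j) * tau\<^sup>2 < 1 * tau\<^sup>2"
    using rot_neq(1)[OF j(1)] rot_bounds[of j] by (intro mult_strict_right_mono) auto
  then show "tau < rot n" "n > 0"
    using rot_B[OF j(1)] j tau_sq by auto
next
  assume n: "n > 0 \<and> tau < rot n"
  obtain i where i: "rot n = of_int i - real n * phi"
    by (rule rot_obtain)
  define f where "f = 1 - rot n"
  have f: "0 < f" "f < 1 - tau"
    using n rot_bounds[of n] by (auto simp: f_def)
  \<comment> \<open>This is \<open>n / phi ^ 2\<close> rounded up: it equals
    \<open>n * (1 - tau) + f\<close> with \<open>1 - tau = 1 / phi ^ 2\<close>, so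
    \<open>j * phi ^ 2\<close> exceeds \<open>n\<close> by \<open>f * phi ^ 2\<close>, which is
    below 1.\<close>
  define j where "j = nat (2 * int n - i + 1)"
  have "0 < real n * (1 - tau) + f"
    using f tau_bounds by (intro add_nonneg_pos) auto
  then have "0 < real_of_int (2 * int n - i + 1)"
    using i by (simp add: f_def phi_tau algebra_simps)
  then have j: "j > 0" "real j = real n * (1 - tau) + f"
    using i by (auto simp: f_def j_def phi_tau algebra_simps)
  have e: "(1 - tau) * phi\<^sup>2 = 1"
    using tau_sq by (simp add: phi_tau power2_eq_square algebra_simps)
  have "real j * phi\<^sup>2 = real n * ((1 - tau) * phi\<^sup>2) + f * phi\<^sup>2"
    by (simp add: j algebra_simps)
  then have "real j * phi\<^sup>2 = real n + f * phi\<^sup>2"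
    using e by simp
  moreover have "f * phi\<^sup>2 < (1 - tau) * phi\<^sup>2"
    using f phi_gt by (intro mult_strict_right_mono) auto
  moreover have "0 < f * phi\<^sup>2"
    using f phi_gt by auto
  ultimately have "\<lfloor>real j * phi\<^sup>2\<rfloor> = int n"
    using e by (intro floor_unique) auto
  then have "B j = n"
    by (simp add: B_def)
  then show "n \<in> B ` {1..}"
    using j by force
qed

lemma A_image_iff: "n \<in> A ` {1..} \<longleftrightarrow> n > 0 \<and> rot n < tau"
proof (intro iffI conjI)
  assume "n \<in> A ` {1..}"
  then obtain j where j: "j > 0" "n = A j" by (auto simp: Suc_le_eq)
  have "1 * 1 < real j * phi"
    using j phi_gt by (intro mult_le_less_imp_less) auto
  then have "1 \<le> \<lfloor>real j * phi\<rfloor>"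
    by linarith
  then show "n > 0"
    by (simp add: A_def j)
  define g where "g = frac (real j * phi)"
  have rn: "real n = real j * phi - g"
    using \<open>1 \<le> _\<close> by (simp add: A_def j g_def frac_def)
  have g: "0 \<le> g * tau" "g * tau < 1 * tau"
    unfolding g_def by (intro mult_nonneg_nonneg mult_strict_right_mono frac_lt_1; simp add: less_imp_le)+
  have "real j * phi * tau = real j"
    by (simp add: tau_def phi_mult algebra_simps)
  then have "real n * tau = real j - g * tau"
    by (simp add: rn algebra_simps)
  moreover have "g * tau < 1"
    using g(2) tau_bounds by linarith
  ultimately have "rot n = g * tau"
    using g(1) by (intro rot_eqI[of _ "int n + int j"])
       (auto simp: phi_tau algebra_simps)
  then show "rot n < tau"
    using g by simp
next
  assume n: "n > 0 \<and> rot n < tau"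
  obtain i where i: "rot n = of_int i - real n * phi"
    by (rule rot_obtain)
  have pos: "0 < rot n"
    using rot_neq(1)[of n] n rot_bounds[of n] by simp
  \<comment> \<open>This is \<open>n / phi\<close> rounded up: it equals
    \<open>n * tau + rot n\<close>, so \<open>j * phi\<close> exceeds \<open>n\<close> by
    \<open>rot n * phi\<close>, which is below 1.\<close>
  define j where "j = nat (i - int n)"
  have "0 < real n * tau + rot n"
    using pos n by (intro add_pos_pos mult_pos_pos) auto
  then have "0 < real_of_int (i - int n)"
    using i by (simp add: phi_tau algebra_simps)
  then have j: "j > 0" "real j = real n * tau + rot n"
    using i by (auto simp: j_def phi_tau algebra_simps)
  have e: "tau * phi = 1"
    using tau_sq by (simp add: phi_tau power2_eq_square algebra_simps)
  have "real j * phi = real n * (tau * phi) + rot n * phi"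
    by (simp add: j algebra_simps)
  then have "real j * phi = real n + rot n * phi"
    using e by simp
  moreover have "rot n * phi < tau * phi"
    using n phi_gt by (intro mult_strict_right_mono) auto
  moreover have "0 < rot n * phi"
    using pos phi_gt by auto
  ultimately have "\<lfloor>real j * phi\<rfloor> = int n"
    using e by (intro floor_unique) auto
  then have "A j = n"
    by (simp add: A_def)
  then show "n \<in> A ` {1..}"
    using j by force
qed

section \<open>Order of dyadic games\<close>

lemma game_leD_left: "game_le G H \<Longrightarrow> G' |\<in>| left_opts G \<Longrightarrow> \<not> game_le H G'"
  and game_leD_right: "game_le G H \<Longrightarrow> H' |\<in>| right_opts H \<Longrightarrow> \<not> game_le H' G"
  by (simp_all add: game_le.simps[of G H])

lemma game_leI:
  assumes "\<And>G'. G' |\<in>| left_opts G \<Longrightarrow> \<not> game_le H G'"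
    and "\<And>H'. H' |\<in>| right_opts H \<Longrightarrow> \<not> game_le H' G"
  shows "game_le G H"
  using assms by (simp add: game_le.simps[of G H])

text \<open>A left option of \<open>G\<close> above \<open>K\<close> would by induction be above
  \<open>H\<close>, against \<open>G \<le> H\<close>. Dually, a right option of \<open>K\<close>
  below \<open>G\<close> would be below \<open>H\<close>.\<close>

lemma game_le_trans: "game_le G H \<Longrightarrow> game_le H K \<Longrightarrow> game_le G K"
proof (induction "size G + size H + size K" arbitrary: G H K rule: less_induct)
  case less
  show ?case
  proof (rule game_leI)
    fix G' assume G': "G' |\<in>| left_opts G"
    have "game_le H G'" if "game_le K G'"
      using less(1)[of H K G'] less(3) that size_left_opt[OF G'] by simp
    then show "\<not> game_le K G'"
      using game_leD_left[OF less(2) G'] by blast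
  next
    fix K' assume K': "K' |\<in>| right_opts K"
    have "game_le K' H" if "game_le K' G"
      using less(1)[of K' G H] less(2) that size_right_opt[OF K'] by simp
    then show "\<not> game_le K' G"
      using game_leD_right[OF less(3) K'] by blast
  qed
qed

lemma dyadic_game_double: "dyadic_game (2 * m) (Suc k) = dyadic_game m k"
  by simp

lemma dyadic_game_odd:
  "dyadic_game (2 * m + 1) (Suc k) = Game {|dyadic_game m k|} {|dyadic_game (m + 1) k|}"
proof -
  have "(2 * m + 2) div 2 = m + 1"
    by simp
  then show ?thesis
    by (simp add: add.commute)
qed

lemma left_opts_nat_game: "left_opts (nat_game n) = (if n = 0 then {||} else {|nat_game (n - 1)|})"
  and right_opts_nat_game: "right_opts (nat_game n) = {||}"
  by (cases n; simp)+

lemma int_parity_cases: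
  fixes m :: int
  obtains m' where "m = 2 * m'" | m' where "m = 2 * m' + 1"
  by (metis evenE oddE)

text \<open>Writing every option over the denominator of the game itself reduces later comparisons
  to numerators.\<close>

lemma dyadic_game_left_opts:
  assumes "m \<ge> 0" "G |\<in>| left_opts (dyadic_game m k)"
  shows "\<exists>m'. 0 \<le> m' \<and> m' < m \<and> G = dyadic_game m' k"
  using assms
proof (induction k arbitrary: m G)
  case 0
  then have "m > 0" "G = nat_game (nat m - 1)"
    by (auto simp: int_game_def left_opts_nat_game split: if_splits)
  then show ?case
    by (intro exI[of _ "m - 1"]) (auto simp: int_game_def nat_diff_distrib)
next
  case (Suc k)
  show ?case
  proof (cases m rule: int_parity_cases)
    case (1 n)
    then obtain n' where "0 \<le> n'" "n' < n" "G = dyadic_game n' k"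
      using Suc.IH[of n G] Suc.prems by auto
    then show ?thesis
      using 1 by (intro exI[of _ "2 * n'"]) auto
  next
    case (2 n)
    then have "G = dyadic_game (2 * n) (Suc k)"
      using Suc.prems by (simp only: dyadic_game_odd) auto
    then show ?thesis
      using 2 Suc.prems by (intro exI[of _ "2 * n"]) auto
  qed
qed

lemma dyadic_game_right_opts:
  assumes "m \<ge> 0" "G |\<in>| right_opts (dyadic_game m k)"
  shows "\<exists>m'. m < m' \<and> G = dyadic_game m' k"
  using assms
proof (induction k arbitrary: m G)
  case 0
  then show ?case
    by (auto simp: int_game_def right_opts_nat_game split: if_splits)
next
  case (Suc k)
  show ?case
  proof (cases m rule: int_parity_cases)
    case (1 n)
    then obtain n' where "n < n'" "G = dyadic_game n' k"
      using Suc.IH[of n G] Suc.prems by auto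
    then show ?thesis
      using 1 by (intro exI[of _ "2 * n'"]) auto
  next
    case (2 n)
    then have "G = dyadic_game (2 * (n + 1)) (Suc k)"
      using Suc.prems by (simp only: dyadic_game_odd) auto
    then show ?thesis
      using 2 by (intro exI[of _ "2 * (n + 1)"]) auto
  qed
qed

text \<open>Of two dyadic numbers, the one with the larger denominator has an option
  on the near side of the other.\<close>

lemma dyadic_game_less_option:
  assumes "0 \<le> m" "m < n"
  shows "(\<exists>n'. m \<le> n' \<and> dyadic_game n' k |\<in>| left_opts (dyadic_game n k)) \<or>
         (\<exists>m'. m' \<le> n \<and> 0 \<le> m' \<and> dyadic_game m' k |\<in>| right_opts (dyadic_game m k))"
  using assms
proof (induction k arbitrary: m n)
  case 0
  then have "dyadic_game (n - 1) 0 |\<in>| left_opts (dyadic_game n 0)"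
    by (auto simp: int_game_def left_opts_nat_game nat_diff_distrib)
  then show ?case
    using 0 by (intro disjI1 exI[of _ "n - 1"]) auto
next
  case (Suc k)
  show ?case
  proof (cases n rule: int_parity_cases)
    case (2 b)
    then have "dyadic_game (2 * b) (Suc k) |\<in>| left_opts (dyadic_game n (Suc k))"
      by (simp only: dyadic_game_odd) auto
    then show ?thesis
      using 2 Suc.prems by (intro disjI1 exI[of _ "2 * b"]) auto
  next
    case n: (1 b)
    show ?thesis
    proof (cases m rule: int_parity_cases)
      case (2 a)
      then have "dyadic_game (2 * (a + 1)) (Suc k) |\<in>| right_opts (dyadic_game m (Suc k))"
        by (simp only: dyadic_game_odd) auto
      then show ?thesis
        using 2 Suc.prems by (intro disjI2 exI[of _ "2 * (a + 1)"]) auto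
    next
      case (1 a)
      then consider b' where "a \<le> b'" "dyadic_game b' k |\<in>| left_opts (dyadic_game b k)"
        | a' where "a' \<le> b" "0 \<le> a'" "dyadic_game a' k |\<in>| right_opts (dyadic_game a k)"
        using Suc.IH[of a b] Suc.prems n by auto
      then show ?thesis
      proof cases
        case (1 b')
        then show ?thesis
          using \<open>m = 2 * a\<close> n by (intro disjI1 exI[of _ "2 * b'"]) auto
      next
        case (2 a')
        then show ?thesis
          using \<open>m = 2 * a\<close> n by (intro disjI2 exI[of _ "2 * a'"]) auto
      qed
    qed
  qed
qed

text \<open>The two halves feed each other: the weak order refutes options through the strict one,
  and the strict order applies the weak one to the option supplied by
  \<open>dyadic_game_less_option\<close>.\<close>

lemma dyadic_game_order:
  assumes "0 \<le> m" "0 \<le> n"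
  shows "(m \<le> n \<longrightarrow> game_le (dyadic_game m k) (dyadic_game n k)) \<and>
         (m < n \<longrightarrow> \<not> game_le (dyadic_game n k) (dyadic_game m k))"
  using assms
proof (induction "size (dyadic_game m k) + size (dyadic_game n k)" arbitrary: m n rule: less_induct)
  case less
  show ?case
  proof (intro conjI impI)
    assume "m \<le> n"
    show "game_le (dyadic_game m k) (dyadic_game n k)"
    proof (rule game_leI)
      fix G assume G: "G |\<in>| left_opts (dyadic_game m k)"
      then obtain m' where "0 \<le> m'" "m' < m" "G = dyadic_game m' k"
        using dyadic_game_left_opts less.prems by blast
      then show "\<not> game_le (dyadic_game n k) G"
        using less.hyps[of m' n] size_left_opt[OF G] \<open>m \<le> n\<close> less.prems by auto
    next
      fix G assume G: "G |\<in>| right_opts (dyadic_game n k)"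
      then obtain n' where "n < n'" "G = dyadic_game n' k"
        using dyadic_game_right_opts less.prems by blast
      then show "\<not> game_le G (dyadic_game m k)"
        using less.hyps[of m n'] size_right_opt[OF G] \<open>m \<le> n\<close> less.prems by auto
    qed
  next
    assume "m < n"
    show "\<not> game_le (dyadic_game n k) (dyadic_game m k)"
    proof
      assume le: "game_le (dyadic_game n k) (dyadic_game m k)"
      consider n' where "m \<le> n'" "dyadic_game n' k |\<in>| left_opts (dyadic_game n k)"
        | m' where "m' \<le> n" "0 \<le> m'" "dyadic_game m' k |\<in>| right_opts (dyadic_game m k)"
        using dyadic_game_less_option[OF less.prems(1) \<open>m < n\<close>] by blast
      then show False
      proof cases
        case (1 n')
        then show False
          using less.hyps[of m n'] less.prems size_left_opt[OF 1(2)] game_leD_left[OF le 1(2)]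
          by auto
      next
        case (2 m')
        then show False
          using less.hyps[of m' n] less.prems size_right_opt[OF 2(3)] game_leD_right[OF le 2(3)]
          by auto
      qed
    qed
  qed
qed

lemma dyadic_game_scale: "dyadic_game (m * 2 ^ j) (k + j) = dyadic_game m k"
proof (induction j)
  case (Suc j)
  then show ?case
    using dyadic_game_double[of "m * 2 ^ j" "k + j"] by (simp add: mult.left_commute)
qed simp

text \<open>Frees \<open>number_game\<close> from the least exponent: an unreduced fraction yields
  the same game, because even numerators are halved by \<open>dyadic_game\<close>.\<close>

lemma number_game_dyadic: "number_game (of_int m / 2 ^ k) = dyadic_game m k"
proof -
  define d :: rat where "d = of_int m / 2 ^ k"
  define l where "l = (LEAST k. d * 2 ^ k \<in> \<int>)"
  have k: "d * 2 ^ k = of_int m"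
    by (simp add: d_def)
  then have "d * 2 ^ k \<in> \<int>"
    by simp
  then have "d * 2 ^ l \<in> \<int>" "l \<le> k"
    unfolding l_def by (rule LeastI, rule Least_le)
  then obtain n where n: "d * 2 ^ l = of_int n"
    by (auto elim: Ints_cases)
  obtain j where j: "k = l + j"
    using \<open>l \<le> k\<close> by (metis le_iff_add)
  have "(of_int m :: rat) = of_int (n * 2 ^ j)"
    using k n by (simp add: j power_add flip: mult.assoc)
  then have "m = n * 2 ^ j"
    by (simp only: of_int_eq_iff)
  then have "dyadic_game m k = dyadic_game n l"
    unfolding j by (simp only: dyadic_game_scale)
  then show ?thesis
    unfolding number_game_def Let_def l_def[symmetric] d_def[symmetric] n by simp
qed

section \<open>The dyadic tree\<close>

text \<open>Row \<open>k\<close> of the dyadic tree: neighbours have numerators \<open>m\<close> and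
  \<open>m + 1\<close>, and their midpoint is \<open>2 * m + 1\<close> in row
  \<open>Suc k\<close>.\<close>

definition dya :: "nat \<Rightarrow> nat \<Rightarrow> rat" where
  "dya m k = of_nat m / 2 ^ k"

lemma dya_double: "dya (2 * m) (Suc k) = dya m k"
  by (simp add: dya_def)

lemma dya_scale: "dya (m * 2 ^ j) (k + j) = dya m k"
  by (simp add: dya_def power_add)

lemma dya_le_iff: "dya m k \<le> dya n k \<longleftrightarrow> m \<le> n" and dya_less_iff: "dya m k < dya n k \<longleftrightarrow> m < n"
  by (auto simp: dya_def divide_simps)

lemma number_game_dya: "number_game (dya m k) = dyadic_game (int m) k"
  using number_game_dyadic[of "int m" k] by (simp add: dya_def)

lemma dya_common:
  obtains i j l where "dya m k = dya i l" "dya n k' = dya j l"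
proof
  show "dya m k = dya (m * 2 ^ k') (k + k')"
    by (simp only: dya_scale)
  show "dya n k' = dya (n * 2 ^ k) (k + k')"
    using dya_scale[of n k k'] by (simp only: add.commute)
qed

lemma number_game_dya_le:
  assumes "dya m k \<le> dya n k'"
  shows "game_le (number_game (dya m k)) (number_game (dya n k'))"
proof -
  obtain i j l where "dya m k = dya i l" "dya n k' = dya j l"
    by (rule dya_common)
  then show ?thesis
    using assms dyadic_game_order[of "int i" "int j" l] by (simp add: number_game_dya dya_le_iff)
qed

lemma number_game_dya_less:
  assumes "dya m k < dya n k'"
  shows "\<not> game_le (number_game (dya n k')) (number_game (dya m k))"
proof -
  obtain i j l where "dya m k = dya i l" "dya n k' = dya j l"
    by (rule dya_common)
  then show ?thesis
    using assms dyadic_game_order[of "int i" "int j" l] by (simp add: number_game_dya dya_less_iff)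
qed

section \<open>Binary digits and the map xi\<close>

lemma digit_dya: "i \<le> k \<Longrightarrow> digit (dya m k) i = m div 2 ^ (k - i) mod 2"
proof -
  assume "i \<le> k"
  then obtain j where "k = i + j"
    by (metis le_iff_add)
  then have "dya m k * 2 ^ i = of_nat m / of_nat (2 ^ (k - i))"
    by (simp add: dya_def power_add)
  then have "\<lfloor>dya m k * 2 ^ i\<rfloor> = int (m div 2 ^ (k - i))"
    by (simp only: floor_divide_of_nat_eq)
  then show ?thesis
    unfolding digit_def by (metis nat_int of_nat_mod of_nat_numeral)
qed

lemma digit_dya_beyond: "k < i \<Longrightarrow> digit (dya m k) i = 0"
proof -
  assume "k < i"
  then obtain j where j: "i = k + Suc j"
    by (metis add_Suc_right less_iff_Suc_add)
  have "dya m k * 2 ^ i = of_int (2 * (int m * 2 ^ j))"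
    by (simp add: j dya_def power_add)
  then have "\<lfloor>dya m k * 2 ^ i\<rfloor> = 2 * (int m * 2 ^ j)"
    by (simp only: floor_of_int)
  then show ?thesis
    by (simp add: digit_def)
qed

lemma digit_dya_odd: "i \<le> k \<Longrightarrow> digit (dya (2 * m + 1) (Suc k)) i = digit (dya m k) i"
proof -
  assume "i \<le> k"
  then have "(2 * m + 1) div 2 ^ (Suc k - i) = m div 2 ^ (k - i)"
    by (simp add: Suc_diff_le div_mult2_eq)
  then show ?thesis
    using \<open>i \<le> k\<close> by (simp add: digit_dya)
qed

lemma xi_index_cong:
  "(\<And>j. j < i \<Longrightarrow> digit d j = digit d' j) \<Longrightarrow> xi_index d i = xi_index d' i"
  by (induction d i rule: xi_index.induct) auto

lemma xi_dya: "xi (dya m k) = (\<Sum>i\<le>k. digit (dya m k) i * fib (xi_index (dya m k) i))"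
proof -
  have "{i. digit (dya m k) i \<noteq> 0} \<subseteq> {..k}"
    by (metis (mono_tags, lifting) atMost_iff digit_dya_beyond mem_Collect_eq not_le subsetI)
  then show ?thesis
    unfolding xi_def by (intro sum.mono_neutral_left) auto
qed

text \<open>An index depends on earlier digits only, so this is the Fibonacci index that a digit
  appended to the expansion would carry.\<close>

definition next_index :: "nat \<Rightarrow> nat \<Rightarrow> nat" where
  "next_index m k = xi_index (dya m k) (Suc k)"

lemma xi_dya_odd: "xi (dya (2 * m + 1) (Suc k)) = xi (dya m k) + fib (next_index m k)"
proof -
  have "digit (dya (2 * m + 1) (Suc k)) (Suc k) = 1"
    by (subst digit_dya) auto
  moreover have "xi_index (dya (2 * m + 1) (Suc k)) i = xi_index (dya m k) i" if "i \<le> Suc k" for i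
    using that by (intro xi_index_cong digit_dya_odd) auto
  ultimately show ?thesis
    using digit_dya_odd[of _ k m] by (simp add: xi_dya next_index_def del: mult_Suc_right)
qed

lemma next_index_even:
  assumes "k > 0"
  shows "next_index (2 * m) (Suc k) = next_index m k + 2"
  using assms digit_dya_beyond[of k "Suc k" m] by (simp add: next_index_def dya_double)

text \<open>After a 1 is appended the last two digits are \<open>m mod 2\<close> and 1; the pattern
  01, which keeps the index, occurs exactly for even \<open>m\<close>.\<close>

lemma next_index_odd:
  assumes "k > 0"
  shows "next_index (2 * m + 1) (Suc k) = (if even m then next_index m k else next_index m k + 2)"
proof -
  have "digit (dya (2 * m + 1) (Suc k)) (Suc k) = 1"
    by (subst digit_dya) auto
  moreover have "digit (dya (2 * m + 1) (Suc k)) k = m mod 2"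
    using digit_dya_odd[of k k m] by (simp add: digit_dya)
  moreover have "xi_index (dya (2 * m + 1) (Suc k)) (Suc k) = next_index m k"
    unfolding next_index_def by (intro xi_index_cong digit_dya_odd) auto
  ultimately show ?thesis
    by (auto simp: next_index_def even_iff_mod_2_eq_zero)
qed

section \<open>Gaps between neighbouring dyadics\<close>

lemma xi_half: "xi (dya 1 1) = 3" and next_index_half: "next_index 1 1 = 4"
  and xi_one: "xi (dya 1 0) = 1"
  by (simp_all add: xi_dya next_index_def digit_dya numeral_eq_Suc)

text \<open>The last binary digit decides which of two shapes the gap between neighbouring
  dyadics has.\<close>

definition node :: "nat \<Rightarrow> nat \<Rightarrow> bool" where
  "node m k \<longleftrightarrow>
     (let p = xi (dya m k); q = xi (dya (m + 1) k); e = next_index m k in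
      even e \<and> e \<ge> 4 \<and> rot q \<le> tau\<^sup>2 \<and>
      (if odd m then p = q + fib (e - 1) \<and> rot q = rot p + tau ^ (e - 1)
       else q = p + fib (e - 2) \<and> rot q = rot p + tau ^ (e - 2)))"

text \<open>The midpoint heap is the left one plus \<open>fib e\<close> with \<open>e\<close> even,
  so its rotation advances by \<open>tau ^ e\<close>. This is less than the gap, which is
  \<open>tau ^ (e - 1)\<close> or \<open>tau ^ (e - 2)\<close>, while \<open>fib e\<close> exceeds
  any surplus of the right heap over the left.\<close>

lemma node_mid:
  assumes "node m k"
  defines "e \<equiv> next_index m k"
  shows "rot (xi (dya (2 * m + 1) (Suc k))) = rot (xi (dya m k)) + tau ^ e"
    and "rot (xi (dya (2 * m + 1) (Suc k))) < rot (xi (dya (m + 1) k))"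
    and "xi (dya m k) < xi (dya (2 * m + 1) (Suc k))"
    and "xi (dya (m + 1) k) < xi (dya (2 * m + 1) (Suc k))"
proof -
  have e: "even e" "e \<ge> 4" "rot (xi (dya (m + 1) k)) \<le> tau\<^sup>2"
    using assms by (auto simp: node_def Let_def)
  have "tau ^ e < tau ^ (e - 1)" "tau ^ e < tau ^ (e - 2)"
    using e by (auto intro!: tau_power_less)
  then have lt: "rot (xi (dya m k)) + tau ^ e < rot (xi (dya (m + 1) k))"
    using assms by (auto simp: node_def Let_def split: if_splits)
  moreover have "tau\<^sup>2 < 1"
    using tau_power_less[of 0 2] by simp
  ultimately show mid: "rot (xi (dya (2 * m + 1) (Suc k))) = rot (xi (dya m k)) + tau ^ e"
    unfolding xi_dya_odd e_def[symmetric] using e by (intro rot_add_fib_even) auto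
  show "rot (xi (dya (2 * m + 1) (Suc k))) < rot (xi (dya (m + 1) k))"
    using lt by (simp only: mid)
  obtain f where f: "e = Suc (Suc f)"
    using e by (intro that[of "e - 2"]) auto
  then have "fib (e - 2) < fib e"
    by (simp add: fib_neq_0_nat)
  then show "xi (dya m k) < xi (dya (2 * m + 1) (Suc k))"
    "xi (dya (m + 1) k) < xi (dya (2 * m + 1) (Suc k))"
    using assms unfolding xi_dya_odd by (auto simp: node_def Let_def split: if_splits)
qed

text \<open>The left half of a gap has width \<open>tau ^ e\<close> and its index has become
  \<open>e + 2\<close>, so it has the even shape.\<close>

lemma node_left:
  assumes "node m k" "k > 0"
  shows "node (2 * m) (Suc k)"
proof -
  have "rot (xi (dya (2 * m + 1) (Suc k))) \<le> tau\<^sup>2"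
    using node_mid(2)[OF assms(1)] assms(1) by (simp add: node_def Let_def)
  then show ?thesis
    using assms node_mid(1)[OF assms(1)] xi_dya_odd[of m k] next_index_even[of k m]
    by (auto simp: node_def Let_def dya_double)
qed

text \<open>The right half always has the odd shape. For odd \<open>m\<close> its width is
  \<open>tau ^ (e - 1) - tau ^ e = tau ^ (e + 1)\<close> and the index grows to
  \<open>e + 2\<close>; for even \<open>m\<close> its width is
  \<open>tau ^ (e - 2) - tau ^ e = tau ^ (e - 1)\<close> and the index must stay \<open>e\<close>.
  This is what the exception for 01 is for.\<close>

lemma node_right:
  assumes "node m k" "k > 0"
  shows "node (2 * m + 1) (Suc k)"
proof -
  define e where "e = next_index m k"
  have e: "even e" "e \<ge> 4"
    using assms by (auto simp: node_def Let_def e_def)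
  then obtain f where f: "e = f + 2" "f \<ge> 2"
    by (intro that[of "e - 2"]) auto
  have d: "dya (2 * m + 1 + 1) (Suc k) = dya (m + 1) k"
    using dya_double[of "m + 1" k] by simp
  have mid: "rot (xi (dya (2 * m + 1) (Suc k))) = rot (xi (dya m k)) + tau ^ e"
      "xi (dya (2 * m + 1) (Suc k)) = xi (dya m k) + fib e"
    using node_mid(1)[OF assms(1)] xi_dya_odd[of m k] by (simp_all only: e_def)
  have rec: "fib (f + 2) = fib (f + 1) + fib f" "fib (f + 3) = fib (f + 2) + fib (f + 1)"
    by (simp_all add: numeral_eq_Suc)
  show ?thesis
    using assms e mid rec next_index_odd[OF assms(2), of m] unfolding node_def Let_def d
    by (auto simp: f tau_mult algebra_simps simp flip: e_def)
qed

lemma fib_3: "fib 3 = 2"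
  by (simp add: numeral_eq_Suc)

lemma node_root: "node 1 1"
proof -
  have "dya (1 + 1) 1 = dya 1 0"
    by (simp add: dya_def)
  then show ?thesis
    unfolding node_def Let_def
    using tau_bounds
    by (simp add: fib_3 xi_half[simplified] xi_one[simplified] next_index_half[simplified] rot_1[simplified] rot_3 tau_sq tau_cube)
qed

lemma node_all:
  assumes "2 ^ k \<le> m" "m < 2 ^ Suc k"
  shows "node m (Suc k)"
  using assms
proof (induction k arbitrary: m)
  case 0
  then have "m = 1" by simp
  then show ?case
    using node_root by simp
next
  case (Suc k)
  have "node (m div 2) (Suc k)"
    using Suc.prems by (intro Suc.IH) auto
  then show ?case
    using node_left[of "m div 2" "Suc k"] node_right[of "m div 2" "Suc k"]
    by (cases "even m") auto
qed

lemma rot_xi_dya_mono: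
  assumes "2 ^ k \<le> m" "m < n" "n \<le> 2 ^ Suc k"
  shows "rot (xi (dya m (Suc k))) < rot (xi (dya n (Suc k)))"
  using assms
proof (induction n)
  case (Suc n)
  have n: "node n (Suc k)"
    using Suc.prems by (intro node_all) auto
  have "rot (xi (dya n (Suc k))) < rot (xi (dya (Suc n) (Suc k)))"
    using n tau_pos by (auto simp: node_def Let_def split: if_splits simp del: tau_pos)
  then show ?case
    using Suc by (cases "m = n") auto
qed simp

text \<open>Bisection: unless \<open>h\<close> is the midpoint heap, it lies in one of the two
  halves and exceeds the midpoint heap by the approximation lemmas, so the excess of
  \<open>h\<close> over the larger end heap drops.\<close>

lemma node_surj:
  assumes "2 ^ k \<le> m" "m < 2 ^ Suc k"
    and "xi (dya m (Suc k)) < h" "xi (dya (m + 1) (Suc k)) < h"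
    and "rot (xi (dya m (Suc k))) < rot h" "rot h < rot (xi (dya (m + 1) (Suc k)))"
  shows "\<exists>m' k'. 2 ^ k' < m' \<and> m' < 2 ^ Suc k' \<and> xi (dya m' (Suc k')) = h"
  using assms
proof (induction "h - max (xi (dya m (Suc k))) (xi (dya (m + 1) (Suc k)))" arbitrary: m k rule: less_induct)
  case less
  define p q e where pqe: "p = xi (dya m (Suc k))" "q = xi (dya (m + 1) (Suc k))" "e = next_index m (Suc k)"
  define c where "c = xi (dya (2 * m + 1) (Suc (Suc k)))"
  have node: "node m (Suc k)"
    using less.prems by (intro node_all)
  have e: "even e" "e \<ge> 4"
    using node by (auto simp: node_def Let_def pqe)
  have d: "dya (2 * m + 1 + 1) (Suc (Suc k)) = dya (m + 1) (Suc k)"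
    using dya_double[of "m + 1" "Suc k"] by simp
  have c: "rot c = rot p + tau ^ e" "p < c" "q < c" "c = p + fib e"
    using node_mid[OF node] xi_dya_odd[of m "Suc k"] by (simp_all only: c_def pqe)
  note pq = less.prems(3-6)[folded pqe]
  consider "rot h < rot c" | "h = c" | "rot c < rot h"
    using rot_inj by force
  then show ?case
  proof cases
    case 1
    then have "p + fib e < h"
      using pq e c by (intro rot_add_approx_below) auto
    then show ?thesis
      using 1 c pq less.prems(1,2)
      by (intro less.hyps[of "2 * m" "Suc k"]) (auto simp: dya_double simp flip: pqe[simplified] c_def[simplified])
  next
    case 2
    then show ?thesis
      using less.prems(1,2) by (intro exI[of _ "2 * m + 1"] exI[of _ "Suc k"]) (auto simp: c_def)
  next
    case 3
    obtain f where f: "e = f + 2" "even f"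
      using e by (intro that[of "e - 2"]) auto
    have rec: "fib (f + 2) = fib (f + 1) + fib f" "fib (f + 3) = fib (f + 2) + fib (f + 1)"
      by (simp_all add: numeral_eq_Suc)
    have trec: "tau ^ (f + 2) = tau ^ f - tau ^ (f + 1)" "tau ^ (f + 3) = tau ^ (f + 1) - tau ^ (f + 2)"
      using tau_power_rec[of f] tau_power_rec[of "f + 1"] by (simp_all add: numeral_eq_Suc)
    \<comment> \<open>The gap from \<open>c\<close> to \<open>q\<close> is an odd power of tau, so
      the estimate runs backwards from \<open>q\<close>; adding to \<open>q\<close> the Fibonacci
      number of the same index gives exactly \<open>c\<close>.\<close>
    have "c < h"
    proof (cases "odd m")
      case True
      then have p: "p = q + fib (f + 1)" and "rot q = rot p + tau ^ (f + 1)"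
        using node by (auto simp: node_def Let_def f simp flip: pqe[simplified])
      then have "q + fib (f + 3) < h"
        using pq c 3 f trec by (intro rot_add_approx_above) auto
      then show ?thesis
        using c p rec f by auto
    next
      case False
      then have q: "q = p + fib f" and "rot q = rot p + tau ^ f"
        using node by (auto simp: node_def Let_def f simp flip: pqe[simplified])
      then have "q + fib (f + 1) < h"
        using pq c 3 f trec by (intro rot_add_approx_above) auto
      then show ?thesis
        using c q rec f by auto
    qed
    have "(2::nat) ^ Suc k \<le> 2 * m + 1" "2 * m + 1 < 2 ^ Suc (Suc k)"
      using less.prems(1,2) by auto
    then show ?thesis
      using 3 c pq \<open>c < h\<close> less.hyps[of "2 * m + 1" "Suc k"] unfolding d
      by (auto simp flip: pqe[simplified] c_def[simplified])
  qed
qed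

text \<open>The bounds are \<open>rot 3 = tau ^ 4\<close> and \<open>rot 1 = tau ^ 2\<close>, the
  ends of the root gap from 1/2 to 1. The heaps 0 to 3 have rotations outside the open interval, so
  \<open>h\<close> exceeds both end heaps.\<close>

lemma xi_surj:
  assumes "tau ^ 4 < rot h" "rot h < tau\<^sup>2"
  shows "\<exists>m k. 2 ^ k < m \<and> m < 2 ^ Suc k \<and> xi (dya m (Suc k)) = h"
proof -
  have "rot h \<noteq> rot 0" "rot h \<noteq> rot 1" "rot h \<noteq> rot 2" "rot h \<noteq> rot 3"
    using assms tau_bounds by (simp_all only: rot_0 rot_1 rot_2 rot_3 tau_sq tau_four)
  then have "h \<noteq> 0" "h \<noteq> 1" "h \<noteq> 2" "h \<noteq> 3"
    by - (rule notI, simp)+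
  then have "h > 3" by auto
  moreover have "dya (1 + 1) 1 = dya 1 0"
    by (simp add: dya_def)
  ultimately show ?thesis
    using assms by (intro node_surj[of 0 1])
      (simp_all add: xi_half[simplified] xi_one[simplified] rot_1[simplified] rot_3 tau_sq tau_four)
qed

section \<open>Moves between heaps\<close>

text \<open>Heap 1 is adjoined because it has value 1, the right end of the tree, and so serves as
  an option of canonical forms and as a reply for Left.\<close>

definition Q1 :: "nat set" where
  "Q1 = Q \<union> {1}"

text \<open>Two contractions towards 1 put \<open>B (B n)\<close> into the rotations above
  \<open>1 - tau ^ 4\<close>; one more counter turns by \<open>tau ^ 2\<close>, across 1, and
  \<open>tau ^ 2 - tau ^ 4 = tau ^ 3\<close>. Conversely \<open>B_image_iff\<close> is applied
  twice.\<close>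

lemma BB_rot_iff: "(\<exists>n\<ge>1. h = B (B n) + 1) \<longleftrightarrow> tau ^ 3 < rot h \<and> rot h < tau\<^sup>2"
proof
  assume "\<exists>n\<ge>1. h = B (B n) + 1"
  then obtain n where n: "n > 0" "h = B (B n) + 1" by (auto simp: Suc_le_eq)
  define x where "x = (1 - rot n) * tau ^ 4"
  have "rot (h - 1) = 1 - x"
    using rot_B[OF n(1)] rot_B[of "B n"] by (simp add: n(2) x_def power_numeral_reduce power2_eq_square)
  moreover have "x < 1 * tau ^ 4"
    using rot_neq(1)[OF n(1)] rot_bounds[of n] unfolding x_def by (intro mult_strict_right_mono) auto
  moreover have "0 < x"
    using rot_bounds[of n] unfolding x_def by (intro mult_pos_pos) auto
  ultimately show "tau ^ 3 < rot h \<and> rot h < tau\<^sup>2"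
    using rot_diff[of 1 h] n(2) rot_bounds[of h] tau_bounds
    by (auto simp: rot_1[simplified] tau_four tau_cube tau_sq split: if_splits)
next
  assume h: "tau ^ 3 < rot h \<and> rot h < tau\<^sup>2"
  then have "h \<noteq> 0" "h \<noteq> 1"
    using tau_bounds rot_1 by (auto simp: tau_cube tau_sq intro: ccontr)
  then have "h - 1 > 0" by simp
  moreover have *: "rot (h - 1) = rot h + tau"
    using rot_diff[of 1 h] h \<open>h \<noteq> 0\<close> by (auto simp: rot_1[simplified] tau_sq)
  moreover have "0 < rot h"
    using h tau_bounds by (simp add: tau_cube)
  ultimately have "h - 1 \<in> B ` {1..}"
    unfolding B_image_iff by simp
  then obtain j where j: "j > 0" "h - 1 = B j" by (auto simp: Suc_le_eq)
  have "1 - (1 - rot j) * tau\<^sup>2 = rot h + tau"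
    using rot_B[OF j(1)] j * by simp
  then have "(1 - rot j) * tau\<^sup>2 < tau ^ 4"
    using h by (simp add: tau_cube tau_four tau_sq)
  also have "tau ^ 4 = tau\<^sup>2 * tau\<^sup>2"
    by (simp flip: power_add)
  finally have "1 - rot j < tau\<^sup>2"
    by (rule mult_right_less_imp_less) simp
  then have "j \<in> B ` {1..}"
    using j unfolding B_image_iff by (simp add: tau_sq)
  then show "\<exists>n\<ge>1. h = B (B n) + 1"
    using j \<open>h \<noteq> 0\<close> by (auto simp: image_iff)
qed

text \<open>Apart from heap 1 this is one open interval of rotations together with a sequence
  converging to its lower end, which is the form used in all later case splits.\<close>

lemma Q1_iff:
  "h \<in> Q1 \<longleftrightarrow> h = 1 \<or> tau ^ 3 < rot h \<and> rot h < tau\<^sup>2 \<or> (\<exists>m\<ge>3. odd m \<and> h = fib m - 2)"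
proof -
  have "(\<exists>n. h = fib (2 * n + 3) - 2) \<longleftrightarrow> (\<exists>m\<ge>3. odd m \<and> h = fib m - 2)"
  proof
    assume "\<exists>m\<ge>3. odd m \<and> h = fib m - 2"
    then obtain m where m: "m \<ge> 3" "odd m" "h = fib m - 2" by blast
    then have "m = 2 * ((m - 3) div 2) + 3"
      by presburger
    then show "\<exists>n. h = fib (2 * n + 3) - 2"
      using m by metis
  qed (metis add.commute dvd_triv_left even_add le_add1 odd_numeral)
  then show ?thesis
    unfolding Q1_def Q_def using BB_rot_iff[of h] by blast
qed

lemma rot_Q1_le: "h \<in> Q1 \<Longrightarrow> rot h \<le> tau\<^sup>2"
proof -
  assume "h \<in> Q1"
  moreover have "rot (fib m - 2) \<le> tau\<^sup>2" if "m \<ge> 3" "odd m" for m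
    using rot_fib_minus_2[of m] that tau_power_less[of 2 3] zero_less_power[OF tau_pos, of m] by linarith
  ultimately show ?thesis
    using rot_1 by (auto simp: Q1_iff tau_sq)
qed

lemma Q1_fibE:
  assumes "h \<in> Q1" "rot h < tau ^ 3"
  obtains M where "odd M" "M \<ge> 3" "h = fib M - 2" "fib M = h + 2" "rot h = tau ^ 3 - tau ^ M"
proof -
  have "h \<noteq> 1"
    using assms(2) rot_1 tau_bounds by (auto simp: tau_cube)
  then obtain M where M: "odd M" "M \<ge> 3" "h = fib M - 2"
    using assms by (auto simp: Q1_iff)
  then show ?thesis
    using rot_fib_minus_2[of M] by (intro that[of M]) auto
qed

lemma not_Q1_cases: "k \<notin> Q1 \<Longrightarrow> k \<noteq> 0 \<and> k \<noteq> 1 \<and> (rot k < tau ^ 3 \<or> tau\<^sup>2 < rot k)"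
proof -
  assume k: "k \<notin> Q1"
  have "0 = fib 3 - 2"
    by (simp add: fib_3)
  then have "k \<noteq> 0"
    using k unfolding Q1_iff by (metis odd_numeral order_refl)
  then show ?thesis
    using k rot_neq(3)[of k] rot_neq(4)[of k] by (auto simp: Q1_iff tau_sq)
qed

text \<open>Otherwise \<open>rot k\<close> lies between \<open>rot h = tau ^ 3 - tau ^ M\<close> and
  \<open>tau ^ 3\<close>. Then \<open>(k + 2) * phi\<close> is less than \<open>tau ^ M\<close>
  above an integer, whence \<open>k + 2 > fib M = h + 2\<close>.\<close>

lemma Q1_upper_gap:
  assumes "h \<in> Q1" "k < h" "rot h < rot k" "rot k \<le> tau\<^sup>2"
  shows "k \<in> Q1"
proof (rule ccontr)
  assume k: "k \<notin> Q1"
  then have lt: "rot k < tau ^ 3"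
    using not_Q1_cases[OF k] assms(4) by auto
  then obtain M where M: "odd M" "fib M = h + 2" "rot h = tau ^ 3 - tau ^ M"
    using Q1_fibE[OF assms(1)] assms(3) by (metis less_trans)
  obtain j where j: "rot k = of_int j - real k * phi"
    by (rule rot_obtain)
  have "fib M < k + 2"
    using M lt j assms(3)
    by (intro approx_above[of _ _ "j + 3"]) (auto simp: tau_cube phi_tau algebra_simps)
  then show False
    using M assms(2) by simp
qed

text \<open>The witness is the heap \<open>fib m - 2\<close> of smallest rotation beyond
  \<open>rot k\<close>, so it cannot pass \<open>rot h\<close>. The difficulty is that it must be
  smaller than \<open>k\<close>.\<close>

lemma Q1_below:
  assumes "h \<in> Q1" "k < h" "rot k < rot h" "k \<notin> Q1"
  obtains q where "q \<in> Q1" "q < k" "rot k < rot q" "rot q \<le> rot h"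
proof -
  have k: "k \<noteq> 0" "rot k < tau ^ 3"
    using not_Q1_cases[OF assms(4)] rot_Q1_le[OF assms(1)] assms(3) by auto
  define s where "s = tau ^ 3 - rot k"
  obtain j where "rot k = of_int j - real k * phi"
    by (rule rot_obtain)
  then have j: "s = real (k + 2) * phi - of_int (j + 3)"
    by (simp add: s_def tau_cube phi_tau algebra_simps)
  have s: "0 < s" "s < tau ^ 3"
    using k rot_neq(1)[of k] rot_bounds[of k] by (auto simp: s_def)
  have "\<exists>n. tau ^ n < s"
    using s tau_bounds by (intro real_arch_pow_inv) auto
  then obtain n where n: "tau ^ n < s" by blast
  define m where "m = (LEAST m. odd m \<and> tau ^ m < s)"
  have "tau ^ (2 * n + 1) < s"
    using n tau_power_le[of n "2 * n + 1"] by simp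
  then have "odd (2 * n + 1) \<and> tau ^ (2 * n + 1) < s"
    by simp
  then have m: "odd m" "tau ^ m < s" and least: "\<And>m'. odd m' \<Longrightarrow> tau ^ m' < s \<Longrightarrow> m \<le> m'"
    unfolding m_def by (metis (mono_tags, lifting) LeastI, metis (mono_tags, lifting) LeastI, metis (mono_tags, lifting) Least_le)
  have "m > 3"
    using m s tau_power_le[of m 3] by (cases "m \<le> 3") auto
  then have "m \<ge> 5"
    using m(1) by presburger
  then obtain l where l: "m = l + 2" "l \<ge> 3"
    by (intro that[of "m - 2"]) auto
  have "odd l"
    using m l by simp
  have "s \<noteq> tau ^ l"
  proof
    assume "s = tau ^ l"
    then have "rot k = rot (fib l - 2)"
      using rot_fib_minus_2(1)[OF \<open>odd l\<close> l(2)] by (simp add: s_def)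
    then have "k = fib l - 2"
      by (rule rot_inj)
    then show False
      using assms(4) \<open>odd l\<close> l by (auto simp: Q1_iff)
  qed
  then have sl: "s < tau ^ l"
    using least[of l] \<open>odd l\<close> l by force
  have "fib l < k + 2"
    using \<open>odd l\<close> s sl unfolding j by (intro approx_above[of _ _ "j + 3"]) auto
  \<comment> \<open>A single approximation only reaches \<open>fib l\<close> with
    \<open>l = m - 2\<close>. After \<open>fib l\<close> is subtracted, the remainder is below an
    integer by \<open>tau ^ l - s < tau ^ (l + 1)\<close>, and the second approximation supplies the
    missing \<open>fib (l + 1)\<close>.\<close>
  moreover have "fib (l + 1) < k + 2 - fib l"
  proof (rule approx_below[of _ _ "j + 3 - int (fib (Suc l))"])
    have "of_int (j + 3 - int (fib (Suc l))) - real (k + 2 - fib l) * phi = tau ^ l - s"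
      using \<open>fib l < k + 2\<close> fib_phi[of l] \<open>odd l\<close> unfolding j by (simp add: of_nat_diff algebra_simps)
    then show "0 < of_int (j + 3 - int (fib (Suc l))) - real (k + 2 - fib l) * phi"
      "of_int (j + 3 - int (fib (Suc l))) - real (k + 2 - fib l) * phi < tau ^ (l + 1)"
      using sl m(2) tau_power_rec[of l] by (auto simp: l)
  qed (use \<open>fib l < k + 2\<close> \<open>odd l\<close> in auto)
  ultimately have "fib m < k + 2"
    by (simp add: l)
  have q: "rot (fib m - 2) = tau ^ 3 - tau ^ m" "fib m \<ge> 2"
    using rot_fib_minus_2[of m] m \<open>m \<ge> 5\<close> by auto
  show ?thesis
  proof
    have "m \<ge> 3"
      using \<open>m \<ge> 5\<close> by simp
    then show "fib m - 2 \<in> Q1"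
      using m(1) unfolding Q1_iff by blast
    show "fib m - 2 < k"
      using \<open>fib m < k + 2\<close> q(2) by simp
    show "rot k < rot (fib m - 2)"
      using q(1) m(2) by (simp add: s_def)
    show "rot (fib m - 2) \<le> rot h"
    proof (cases "rot h < tau ^ 3")
      case True
      then obtain M where M: "odd M" "rot h = tau ^ 3 - tau ^ M"
        using Q1_fibE[OF assms(1)] by metis
      then have "m \<le> M"
        using assms(3) by (intro least) (auto simp: s_def)
      then show ?thesis
        using M q(1) tau_power_le[of m M] by simp
    next
      case False
      then show ?thesis
        using q(1) zero_less_power[OF tau_pos, of m] by linarith
    qed
  qed
qed

text \<open>\<open>rot (h - k)\<close> is \<open>rot h - rot k\<close> modulo 1; the second
  alternative is the wrapped case, with threshold \<open>1 - tau = tau ^ 2\<close>.\<close>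

lemma move_A_iff:
  assumes "k < h"
  shows "h - k \<in> A ` {1..} \<longleftrightarrow> (rot k < rot h \<and> rot h < rot k + tau) \<or> rot h + tau\<^sup>2 < rot k"
proof -
  have "rot h \<noteq> rot k"
    using rot_inj assms by blast
  then consider "rot h < rot k" | "rot k < rot h"
    by linarith
  then show ?thesis
    using assms rot_diff[of k h] rot_bounds[of h] unfolding A_image_iff
    by cases (auto simp: tau_sq)
qed

lemma move_B_iff:
  assumes "k < h"
  shows "h - k \<in> B ` {1..} \<longleftrightarrow> (rot h < rot k \<and> rot k < rot h + tau\<^sup>2) \<or> rot k + tau < rot h"
proof -
  have "rot h \<noteq> rot k"
    using rot_inj assms by blast
  then consider "rot h < rot k" | "rot k < rot h"
    by linarith
  then show ?thesis
    using assms rot_diff[of k h] rot_bounds[of k] unfolding B_image_iff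
    by cases (auto simp: tau_sq)
qed

text \<open>Ensures that after a wrapped Left move Right can take the whole heap. Otherwise
  \<open>h = fib M - 2\<close> and \<open>(h - k + 1) * phi\<close> is less than
  \<open>tau ^ M\<close> above an integer, so \<open>h - k + 1\<close> would exceed
  \<open>fib M = h + 2\<close>.\<close>

lemma move_A_Q1_far:
  assumes "h \<in> Q1" "k < h" "rot h + tau\<^sup>2 < rot k"
  shows "tau < rot k"
proof (rule ccontr)
  assume "\<not> tau < rot k"
  then have k: "rot k < tau"
    using rot_neq(2)[of k] by simp
  then have "rot h < tau ^ 3"
    using assms(3) by (simp add: tau_sq tau_cube)
  then obtain M where M: "odd M" "fib M = h + 2" "rot h = tau ^ 3 - tau ^ M"
    using Q1_fibE[OF assms(1)] by metis
  have "rot k < 1"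
    using rot_bounds by simp
  obtain i where i: "rot h = of_int i - real h * phi"
    by (rule rot_obtain)
  obtain j where j: "rot k = of_int j - real k * phi"
    by (rule rot_obtain)
  have "real (h - k + 1) = real h - real k + 1"
    using assms(2) by (simp add: of_nat_diff)
  then have eq: "real (h - k + 1) * phi - of_int (i - j + 2) = rot k - rot h - 1 + tau"
    using i j by (simp add: algebra_simps phi_tau)
  have "0 < rot k - rot h - 1 + tau" "rot k - rot h - 1 + tau < tau ^ M"
    using M k assms(3) by (auto simp: tau_cube tau_sq)
  then have "fib M < h - k + 1"
    using M(1) unfolding eq[symmetric] by (intro approx_above[of _ _ "i - j + 2"]) auto
  then show False
    using M by simp
qed

section \<open>Values of heaps\<close>

text \<open>The pair of heap 0 and value 0 is outside the range of delta but occurs as an option of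
  1/2 and of 1.\<close>

definition heap_val :: "nat \<Rightarrow> rat \<Rightarrow> bool" where
  "heap_val h d \<longleftrightarrow> d = 0 \<and> h = 0 \<or> is_delta h d"

lemma dya_simps: "dya 0 k = 0" "dya 1 0 = 1" "dya 1 1 = 1 / 2" "dya (2 ^ k) k = 1"
    "dya (2 ^ k) (Suc k) = 1 / 2"
  by (simp_all add: dya_def)

lemma dya_half_one_iff:
  "1 / 2 \<le> dya m (Suc k) \<longleftrightarrow> 2 ^ k \<le> m" "dya m (Suc k) \<le> 1 \<longleftrightarrow> m \<le> 2 ^ Suc k"
  using dya_le_iff[of "2 ^ k" "Suc k" m] dya_le_iff[of m "Suc k" "2 ^ Suc k"]
  by (simp_all only: dya_simps)

lemma dyadic_dya: "dyadic (dya m k)"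
  unfolding dyadic_def dya_def by (metis of_int_of_nat_eq)

lemma is_delta_dya:
  assumes "2 ^ k \<le> m" "m \<le> 2 ^ Suc k"
  shows "is_delta (xi (dya m (Suc k))) (dya m (Suc k))"
  using assms unfolding is_delta_def by (simp only: dyadic_dya dya_half_one_iff simp_thms)

lemma dyadic_obtain_dya:
  assumes "dyadic d" "0 \<le> d"
  obtains m k where "d = dya m (Suc k)"
proof -
  obtain i k where d: "d = of_int i / 2 ^ k"
    using assms(1) by (auto simp: dyadic_def)
  then have "0 \<le> i"
    using assms(2) by (auto simp: zero_le_divide_iff dest: leD)
  then have "d = dya (2 * nat i) (Suc k)"
    unfolding dya_double by (simp add: d dya_def)
  then show ?thesis ..
qed

lemma is_delta_obtain:
  assumes "is_delta h d"
  obtains m k where "d = dya m (Suc k)" "2 ^ k \<le> m" "m \<le> 2 ^ Suc k" "xi (dya m (Suc k)) = h"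
proof -
  obtain m k where d: "d = dya m (Suc k)"
    using assms by (auto simp: is_delta_def intro: dyadic_obtain_dya[of d])
  moreover have "2 ^ k \<le> m \<and> m \<le> 2 ^ Suc k"
    using assms unfolding is_delta_def d dya_half_one_iff by simp
  ultimately show ?thesis
    using assms by (intro that[of m k]) (auto simp: is_delta_def)
qed

text \<open>Over a common denominator this is \<open>rot_xi_dya_mono\<close>. Applied with
  \<open>h = h'\<close> it gives the uniqueness of delta.\<close>

lemma is_delta_rot_mono:
  assumes "is_delta h d" "is_delta h' d'" "d < d'"
  shows "rot h < rot h'"
proof -
  obtain m k where m: "d = dya m (Suc k)" "2 ^ k \<le> m" "xi (dya m (Suc k)) = h"
    using is_delta_obtain[OF assms(1)] by metis
  obtain n l where n: "d' = dya n (Suc l)" "n \<le> 2 ^ Suc l" "xi (dya n (Suc l)) = h'"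
    using is_delta_obtain[OF assms(2)] by metis
  have d: "d = dya (m * 2 ^ l) (Suc (k + l))" "d' = dya (n * 2 ^ k) (Suc (k + l))"
    using dya_scale[of m l "Suc k"] dya_scale[of n k "Suc l"] m n by (simp_all add: add.commute)
  have "rot (xi (dya (m * 2 ^ l) (Suc (k + l)))) < rot (xi (dya (n * 2 ^ k) (Suc (k + l))))"
  proof (rule rot_xi_dya_mono)
    show "2 ^ (k + l) \<le> m * 2 ^ l"
      using m by (simp add: power_add)
    show "m * 2 ^ l < n * 2 ^ k"
      using assms(3) unfolding d dya_less_iff .
    show "n * 2 ^ k \<le> 2 ^ Suc (k + l)"
      using mult_right_mono[OF n(2), of "2 ^ k"] by (simp add: power_add algebra_simps)
  qed
  then show ?thesis
    using m n d by simp
qed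

lemma is_delta_half: "is_delta 3 (1 / 2)"
  using is_delta_dya[of 0 1] by (simp add: xi_half del: One_nat_def flip: One_nat_def dya_simps(3))

lemma is_delta_one: "is_delta 1 1"
  using is_delta_dya[of 0 2] dya_double[of 1 0] by (simp add: xi_one[unfolded dya_simps(2)] dya_simps(2) del: One_nat_def)

lemma heap_val_rot_mono:
  assumes "heap_val h d" "heap_val h' d'" "d < d'"
  shows "rot h < rot h'"
proof -
  have pos: "0 < rot h'" if "is_delta h' d'"
  proof (cases "d' = 1 / 2")
    case True
    then have "h' = 3"
      using that is_delta_half unfolding is_delta_def by metis
    then show ?thesis
      using tau_bounds by (simp add: rot_3)
  next
    case False
    then have "rot 3 < rot h'"
      using that by (intro is_delta_rot_mono[OF is_delta_half that]) (simp add: is_delta_def)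
    then show ?thesis
      using rot_bounds[of 3] by simp
  qed
  have "d' \<noteq> 0"
    using assms by (auto simp: heap_val_def is_delta_def)
  then have "is_delta h' d'"
    using assms(2) by (auto simp: heap_val_def)
  then show ?thesis
    using assms pos is_delta_rot_mono by (auto simp: heap_val_def)
qed

lemma heap_val_fun: "heap_val h d \<Longrightarrow> heap_val h' d \<Longrightarrow> h = h'"
  by (auto simp: heap_val_def is_delta_def)

lemma heap_val_le: "heap_val h d \<Longrightarrow> heap_val h' d' \<Longrightarrow> rot h \<le> rot h' \<Longrightarrow> d \<le> d'"
  using heap_val_rot_mono by (meson linorder_not_le)

lemma heap_val_less: "heap_val h d \<Longrightarrow> heap_val h' d' \<Longrightarrow> rot h < rot h' \<Longrightarrow> d < d'"
  using heap_val_le heap_val_fun by (metis less_le)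

lemma heap_val_one: "heap_val 1 1" and heap_val_zero: "heap_val 0 0"
  and heap_val_half: "heap_val 3 (1 / 2)"
  using is_delta_one is_delta_half by (auto simp: heap_val_def)

lemma heap_val_le_1: "heap_val h d \<Longrightarrow> d \<le> 1"
  by (auto simp: heap_val_def is_delta_def)

lemma heap_val_rot_le: "heap_val h d \<Longrightarrow> rot h \<le> tau\<^sup>2"
proof -
  assume d: "heap_val h d"
  then consider "d = 1" | "d < 1"
    using heap_val_le_1 by fastforce
  then show ?thesis
  proof cases
    case 1
    then show ?thesis
      using d heap_val_fun[OF d] heap_val_one by (auto simp: rot_1[simplified] tau_sq)
  next
    case 2
    then show ?thesis
      using heap_val_rot_mono[OF d heap_val_one] rot_1 by (simp add: tau_sq)
  qed
qed

lemma heap_val_dya: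
  assumes "heap_val h d"
  obtains m k where "d = dya m k"
proof (cases "d = 0")
  case True
  then show ?thesis
    using that[of 0 0] by (simp add: dya_simps)
next
  case False
  then have "is_delta h d"
    using assms by (simp add: heap_val_def)
  then show ?thesis
    using that by (metis is_delta_obtain)
qed

lemma number_game_heap_val_le:
  "heap_val h d \<Longrightarrow> heap_val h' d' \<Longrightarrow> d \<le> d' \<Longrightarrow> game_le (number_game d) (number_game d')"
  by (metis heap_val_dya number_game_dya_le)

lemma number_game_heap_val_less:
  "heap_val h d \<Longrightarrow> heap_val h' d' \<Longrightarrow> d < d' \<Longrightarrow> \<not> game_le (number_game d') (number_game d)"
  by (metis heap_val_dya number_game_dya_less)

text \<open>Away from 0, 1 and 3 the rotation lies strictly between \<open>rot 3\<close> and
  \<open>rot 1\<close>, where \<open>xi_surj\<close> applies; for the sequence this holds because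
  \<open>tau ^ 3 - tau ^ 5 = tau ^ 4\<close>.\<close>

lemma heap_val_exists:
  assumes "h \<in> Q1"
  obtains d where "heap_val h d"
proof -
  consider "h = 0" | "h = 1" | "h = 3" | "h \<noteq> 0" "h \<noteq> 1" "h \<noteq> 3"
    by blast
  then show ?thesis
  proof cases
    case 4
    have "tau ^ 4 < rot h"
    proof (cases "rot h < tau ^ 3")
      case True
      then obtain M where M: "odd M" "M \<ge> 3" "h = fib M - 2" "rot h = tau ^ 3 - tau ^ M"
        using Q1_fibE[OF assms] by metis
      then have "M \<noteq> 3"
        using 4 by (auto simp: fib_3)
      then have "M \<ge> 5"
        using M by presburger
      then have "tau ^ 4 \<le> rot h"
        using M tau_power_le[of 5 M] tau_power_rec[of 3] by simp
      moreover have "rot h \<noteq> tau ^ 4"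
        using rot_inj[of h 3] 4 by (auto simp: rot_3 tau_four)
      ultimately show ?thesis by simp
    next
      case False
      then show ?thesis
        using tau_power_less[of 3 4] by simp
    qed
    moreover have "rot h < tau\<^sup>2"
      using rot_Q1_le[OF assms] rot_neq(4)[of h] 4 by (auto simp: tau_sq)
    ultimately obtain m k where "2 ^ k < m" "m < 2 ^ Suc k" "xi (dya m (Suc k)) = h"
      using xi_surj by blast
    then show ?thesis
      using is_delta_dya[of k m] that by (auto simp: heap_val_def)
  qed (use that heap_val_zero heap_val_one heap_val_half in auto)
qed

text \<open>Cancelling twos exposes the form in which \<open>dyadic_game_odd\<close> reads off the
  canonical options.\<close>

lemma dya_odd_form:
  assumes "2 ^ k < m" "m < 2 ^ Suc k"
  shows "\<exists>m' k'. dya m (Suc k) = dya (2 * m' + 1) (Suc (Suc k')) \<and> 2 ^ k' \<le> m' \<and> m' < 2 ^ Suc k'"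
  using assms
proof (induction k arbitrary: m)
  case (Suc k)
  show ?case
  proof (cases "even m")
    case True
    then obtain n where n: "m = 2 * n" by blast
    show ?thesis
      using Suc.IH[of n] Suc.prems by (simp add: n dya_double)
  next
    case False
    then obtain n where n: "m = 2 * n + 1" by (blast elim: oddE)
    then show ?thesis
      using Suc.prems by (intro exI[of _ n] exI[of _ k]) auto
  qed
qed simp

text \<open>For a reduced fraction strictly between 1/2 and 1 the options are its two neighbours one
  row up, and \<open>node_mid\<close> compares their heaps with \<open>h\<close>. The values 0, 1
  and 1/2 are checked directly.\<close>

lemma number_game_heap_val_opts:
  assumes "heap_val h d"
  shows "L |\<in>| left_opts (number_game d) \<Longrightarrow>
      \<exists>p d'. L = number_game d' \<and> heap_val p d' \<and> p < h \<and> rot p < rot h"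
    and "R |\<in>| right_opts (number_game d) \<Longrightarrow>
      \<exists>p d'. R = number_game d' \<and> heap_val p d' \<and> p < h \<and> rot h < rot p"
proof -
  have zero: "number_game 0 = dyadic_game 0 0" and one: "number_game 1 = dyadic_game 1 0"
    using number_game_dya[of 0 0] number_game_dya[of 1 0] by (simp_all add: dya_simps[simplified])
  have half: "number_game (1 / 2) = Game {|number_game 0|} {|number_game 1|}"
  proof -
    have "number_game (1 / 2) = dyadic_game 1 1"
      by (metis dya_simps(3) number_game_dya of_nat_1)
    then show ?thesis
      using dyadic_game_odd[of 0 0] by (simp add: zero one)
  qed
  have "rot 3 < rot 1" "0 < rot 3" "0 < rot 1"
    using tau_bounds unfolding rot_1 rot_3 by simp_all
  note small = this heap_val_zero heap_val_one
  consider "d = 0" "h = 0" | "d = 1" "h = 1" | "d = 1 / 2" "h = 3"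
    | m k where "d = dya (2 * m + 1) (Suc (Suc k))" "2 ^ k \<le> m" "m < 2 ^ Suc k"
        "h = xi (dya (2 * m + 1) (Suc (Suc k)))"
  proof (cases "d = 0 \<or> d = 1 \<or> d = 1 / 2")
    case True
    then show ?thesis
      using that(1-3) assms heap_val_fun heap_val_zero heap_val_one heap_val_half by metis
  next
    case False
    then have "is_delta h d"
      using assms by (auto simp: heap_val_def)
    then obtain m k where m: "d = dya m (Suc k)" "2 ^ k \<le> m" "m \<le> 2 ^ Suc k" "xi d = h"
      using is_delta_obtain by metis
    then have "m \<noteq> 2 ^ k" "m \<noteq> 2 ^ Suc k"
      using False dya_simps(4)[of "Suc k"] dya_simps(5)[of k] by auto
    then show ?thesis
      using dya_odd_form[of k m] m that(4) by (metis le_neq_implies_less)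
  qed
  then have "(\<forall>L. L |\<in>| left_opts (number_game d) \<longrightarrow>
      (\<exists>p d'. L = number_game d' \<and> heap_val p d' \<and> p < h \<and> rot p < rot h)) \<and>
    (\<forall>R. R |\<in>| right_opts (number_game d) \<longrightarrow>
      (\<exists>p d'. R = number_game d' \<and> heap_val p d' \<and> p < h \<and> rot h < rot p))"
  proof cases
    case 1
    then show ?thesis
      by (simp add: zero int_game_def)
  next
    case 2
    have "number_game 1 = Game {|number_game 0|} {||}"
      by (simp add: zero one int_game_def)
    then show ?thesis
      using 2 small by (intro conjI allI impI exI[of _ 0]) auto
  next
    case 3
    have "\<exists>p d'. number_game 0 = number_game d' \<and> heap_val p d' \<and> p < 3 \<and> rot p < rot 3"
      using small by (intro exI[of _ 0] exI[of _ "0 :: rat"]) auto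
    moreover have "\<exists>p d'. number_game 1 = number_game d' \<and> heap_val p d' \<and> p < 3 \<and> rot 3 < rot p"
      using small by (intro exI[of _ 1] exI[of _ "1 :: rat"]) auto
    ultimately show ?thesis
      unfolding 3 half by simp
  next
    case (4 m k)
    have eq: "number_game d = Game {|number_game (dya m (Suc k))|} {|number_game (dya (m + 1) (Suc k))|}"
      using dyadic_game_odd[of "int m" "Suc k"] unfolding 4 number_game_dya
      by (simp add: add.commute del: dyadic_game.simps)
    have "heap_val (xi (dya m (Suc k))) (dya m (Suc k))"
      "heap_val (xi (dya (m + 1) (Suc k))) (dya (m + 1) (Suc k))"
      using 4 is_delta_dya[of k m] is_delta_dya[of k "m + 1"] by (auto simp: heap_val_def)
    moreover have "rot (xi (dya m (Suc k))) < rot h"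
      using node_mid(1)[OF node_all[OF 4(2,3)]] 4(4) zero_less_power[OF tau_pos] by simp
    moreover have "rot h < rot (xi (dya (m + 1) (Suc k)))" "xi (dya m (Suc k)) < h"
      "xi (dya (m + 1) (Suc k)) < h"
      using node_mid[OF node_all[OF 4(2,3)]] unfolding 4(4) by auto
    ultimately show ?thesis
      unfolding eq by (simp del: Suc_eq_plus1) blast
  qed
  then show "L |\<in>| left_opts (number_game d) \<Longrightarrow>
      \<exists>p d'. L = number_game d' \<and> heap_val p d' \<and> p < h \<and> rot p < rot h"
    "R |\<in>| right_opts (number_game d) \<Longrightarrow>
      \<exists>p d'. R = number_game d' \<and> heap_val p d' \<and> p < h \<and> rot h < rot p"
    by blast+
qed

section \<open>Play on GoldenNugget heaps\<close>

lemma golden_nugget_left_opts: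
  "G |\<in>| left_opts (golden_nugget h) \<longleftrightarrow> (\<exists>k<h. h - k \<in> A ` {1..} \<and> G = golden_nugget k)"
proof
  assume "G |\<in>| left_opts (golden_nugget h)"
  then obtain a where "1 \<le> a" "a \<le> h" "a \<in> A ` {1..}" "G = golden_nugget (h - a)"
    by (subst (asm) golden_nugget.simps) (auto simp: fset_of_list_elem simp del: One_nat_def)
  then show "\<exists>k<h. h - k \<in> A ` {1..} \<and> G = golden_nugget k"
    by (intro exI[of _ "h - a"]) auto
next
  assume "\<exists>k<h. h - k \<in> A ` {1..} \<and> G = golden_nugget k"
  then obtain k where k: "k < h" "h - k \<in> A ` {1..}" "G = golden_nugget (h - (h - k))" by auto
  then show "G |\<in>| left_opts (golden_nugget h)"
    by (subst golden_nugget.simps) (force simp: fset_of_list_elem)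
qed

lemma golden_nugget_right_opts:
  "G |\<in>| right_opts (golden_nugget h) \<longleftrightarrow> (\<exists>k<h. h - k \<in> B ` {1..} \<and> G = golden_nugget k)"
proof
  assume "G |\<in>| right_opts (golden_nugget h)"
  then obtain a where "1 \<le> a" "a \<le> h" "a \<in> B ` {1..}" "G = golden_nugget (h - a)"
    by (subst (asm) golden_nugget.simps) (auto simp: fset_of_list_elem simp del: One_nat_def)
  then show "\<exists>k<h. h - k \<in> B ` {1..} \<and> G = golden_nugget k"
    by (intro exI[of _ "h - a"]) auto
next
  assume "\<exists>k<h. h - k \<in> B ` {1..} \<and> G = golden_nugget k"
  then obtain k where k: "k < h" "h - k \<in> B ` {1..}" "G = golden_nugget (h - (h - k))" by auto
  then show "G |\<in>| right_opts (golden_nugget h)"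
    by (subst golden_nugget.simps) (force simp: fset_of_list_elem)
qed

text \<open>Right answers an unwrapped Left move with the heap from \<open>Q1_below\<close> and a
  wrapped one by taking everything. The bound \<open>rot q \<le> rot h\<close> says that the value
  reached is at most that of \<open>h\<close>.\<close>

lemma right_reply_to_Q1:
  assumes "h \<in> Q1" "k < h" "h - k \<in> A ` {1..}" "k \<notin> Q1"
  obtains q where "q \<in> Q1" "q < k" "k - q \<in> B ` {1..}" "rot q \<le> rot h"
proof -
  have k: "k \<noteq> 0" "0 < rot k"
    using not_Q1_cases[OF assms(4)] rot_neq(1)[of k] rot_bounds[of k] by auto
  consider "rot k < rot h" | "rot h + tau\<^sup>2 < rot k"
    using assms(3) move_A_iff[OF assms(2)] by blast
  then show ?thesis
  proof cases
    case 1
    then obtain q where q: "q \<in> Q1" "q < k" "rot k < rot q" "rot q \<le> rot h"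
      using Q1_below assms by metis
    then have "k - q \<in> B ` {1..}"
      using k rot_Q1_le[of q] unfolding move_B_iff[OF q(2)] by auto
    with q show ?thesis
      using that by blast
  next
    case 2
    have "0 \<in> Q1"
      using not_Q1_cases by blast
    moreover have "k - 0 \<in> B ` {1..}"
      using k move_A_Q1_far[OF assms(1,2) 2] by (subst move_B_iff) auto
    ultimately show ?thesis
      using k rot_bounds[of h] by (intro that[of 0]) auto
  qed
qed

lemma game_eq_heap_val:
  assumes "h \<in> Q1" "heap_val h d"
  shows "game_eq (golden_nugget h) (number_game d)"
  using assms
proof (induction h arbitrary: d rule: less_induct)
  case (less h)
  have le: "game_le (golden_nugget q) (number_game d')" "game_le (number_game d') (golden_nugget q)"
    if "q < h" "q \<in> Q1" "heap_val q d'" for q d'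
    using less.IH[OF that] by (auto simp: game_eq_def)
  have h: "0 \<le> rot h" "rot h \<le> tau\<^sup>2" "tau\<^sup>2 < tau"
    using rot_bounds rot_Q1_le[OF less.prems(1)] tau_bounds by (auto simp: tau_sq)
  have "game_le (golden_nugget h) (number_game d)"
  proof (rule game_leI)
    fix G assume "G |\<in>| left_opts (golden_nugget h)"
    then obtain k where k: "k < h" "h - k \<in> A ` {1..}" "G = golden_nugget k"
      using golden_nugget_left_opts by blast
    show "\<not> game_le (number_game d) G"
    proof (cases "k \<in> Q1")
      case True
      then obtain dk where dk: "heap_val k dk"
        by (rule heap_val_exists)
      have "rot k < rot h"
        using k(2) rot_Q1_le[OF True] h unfolding move_A_iff[OF k(1)] by auto
      then have "\<not> game_le (number_game d) (number_game dk)"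
        using number_game_heap_val_less[OF dk less.prems(2)] heap_val_less[OF dk less.prems(2)] by blast
      then show ?thesis
        using game_le_trans le(1)[OF k(1) True dk] k(3) by blast
    next
      case False
      then obtain q where q: "q \<in> Q1" "q < k" "k - q \<in> B ` {1..}" "rot q \<le> rot h"
        using right_reply_to_Q1[OF less.prems(1) k(1,2)] by metis
      obtain dq where dq: "heap_val q dq"
        using q(1) by (rule heap_val_exists)
      have "game_le (number_game dq) (number_game d)"
        using number_game_heap_val_le[OF dq less.prems(2)] heap_val_le[OF dq less.prems(2) q(4)] by blast
      then have "game_le (golden_nugget q) (number_game d)"
        using game_le_trans le(1)[OF _ q(1) dq] q(2) k(1) by (meson less_trans)
      moreover have "golden_nugget q |\<in>| right_opts G"
        using golden_nugget_right_opts q(2,3) k(3) by blast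
      ultimately show ?thesis
        using game_leD_right by blast
    qed
  next
    fix R assume "R |\<in>| right_opts (number_game d)"
    then obtain p d' where p: "R = number_game d'" "heap_val p d'" "p < h" "rot h < rot p"
      using number_game_heap_val_opts(2)[OF less.prems(2)] by blast
    \<comment> \<open>So the canonical right option is itself the value of a heap covered by the
      induction hypothesis.\<close>
    have "p \<in> Q1"
      using Q1_upper_gap[OF less.prems(1) p(3,4)] heap_val_rot_le[OF p(2)] .
    have "0 < rot h"
      using h p(3) rot_neq(1)[of h] by auto
    then have "golden_nugget p |\<in>| right_opts (golden_nugget h)"
      using p(3,4) heap_val_rot_le[OF p(2)] golden_nugget_right_opts move_B_iff[OF p(3)] by fastforce
    then show "\<not> game_le R (golden_nugget h)"
      using game_leD_right le(1)[OF p(3) \<open>p \<in> Q1\<close> p(2)] p(1) by blast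
  qed
  moreover have "game_le (number_game d) (golden_nugget h)"
  proof (rule game_leI)
    fix L assume "L |\<in>| left_opts (number_game d)"
    then obtain p d' where p: "L = number_game d'" "heap_val p d'" "p < h" "rot p < rot h"
      using number_game_heap_val_opts(1)[OF less.prems(2)] by blast
    \<comment> \<open>The heap of a canonical left option may lie outside \<open>Q1\<close>; it is
      then replaced by a smaller heap of \<open>Q1\<close> whose value is at least as large.\<close>
    obtain q where q: "q \<in> Q1" "q \<le> p" "rot p \<le> rot q" "rot q \<le> rot h"
    proof (cases "p \<in> Q1")
      case True
      then show ?thesis
        using that[of p] p(4) by simp
    next
      case False
      then show ?thesis
        using Q1_below[OF less.prems(1) p(3,4)] that by (metis less_imp_le)
    qed
    then have "q < h"
      using p(3) by simp
    obtain dq where dq: "heap_val q dq"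
      using q(1) by (rule heap_val_exists)
    have "rot q < rot h"
      using q(4) rot_inj[of q h] \<open>q < h\<close> by fastforce
    then have "golden_nugget q |\<in>| left_opts (golden_nugget h)"
      using \<open>q < h\<close> h rot_bounds(1)[of q] golden_nugget_left_opts move_A_iff[OF \<open>q < h\<close>] by fastforce
    moreover have "game_le (number_game d') (golden_nugget q)"
      using game_le_trans le(2)[OF \<open>q < h\<close> q(1) dq] number_game_heap_val_le[OF p(2) dq]
        heap_val_le[OF p(2) dq q(3)] by blast
    ultimately show "\<not> game_le (golden_nugget h) L"
      using game_leD_left p(1) by blast
  next
    fix G assume "G |\<in>| right_opts (golden_nugget h)"
    then obtain k where k: "k < h" "h - k \<in> B ` {1..}" "G = golden_nugget k"
      using golden_nugget_right_opts by blast
    have rk: "rot h < rot k" "rot k < 1"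
      using k(2) h rot_bounds[of k] unfolding move_B_iff[OF k(1)] by auto
    show "\<not> game_le G (number_game d)"
    proof (cases "k \<in> Q1")
      case True
      then obtain dk where dk: "heap_val k dk"
        by (rule heap_val_exists)
      have "\<not> game_le (number_game dk) (number_game d)"
        using number_game_heap_val_less[OF less.prems(2) dk] heap_val_less[OF less.prems(2) dk rk(1)] by blast
      then show ?thesis
        using game_le_trans le(2)[OF k(1) True dk] k(3) by blast
    next
      case False
      \<comment> \<open>A Right move out of \<open>Q1\<close> overshoots
        \<open>tau ^ 2 = rot 1\<close>, so Left can answer by moving to heap 1, whose value 1 is the
        largest possible.\<close>
      then have "1 < k" "tau\<^sup>2 < rot k"
        using not_Q1_cases[OF False] Q1_upper_gap[OF less.prems(1) k(1) rk(1)] by force+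
      have "k - 1 \<in> A ` {1..}"
        unfolding move_A_iff[OF \<open>1 < k\<close>] rot_1 using rk \<open>tau\<^sup>2 < rot k\<close> by (simp add: tau_sq)
      then have "golden_nugget 1 |\<in>| left_opts G"
        using golden_nugget_left_opts \<open>1 < k\<close> k(3) by blast
      moreover have "1 \<in> Q1"
        by (simp add: Q1_iff)
      then have "game_le (number_game 1) (golden_nugget 1)"
        using le(2)[of 1 1] heap_val_one \<open>1 < k\<close> k(1) by simp
      then have "game_le (number_game d) (golden_nugget 1)"
        using game_le_trans number_game_heap_val_le[OF less.prems(2) heap_val_one]
          heap_val_le_1[OF less.prems(2)] by blast
      ultimately show ?thesis
        using game_leD_left by blast
    qed
  qed
  ultimately show ?case
    by (simp add: game_eq_def)
qed

theorem theorem4p9: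
  fixes h :: nat
  assumes "h \<in> Q" and "h \<noteq> 0"
  shows "(\<exists>!d. is_delta h d) \<and> game_eq (golden_nugget h) (number_game (delta h))"
proof -
  have "h \<in> Q1"
    using assms(1) by (simp add: Q1_def)
  then obtain d where "heap_val h d"
    by (rule heap_val_exists)
  then have "is_delta h d"
    using assms(2) by (simp add: heap_val_def)
  moreover have "d' = d" if "is_delta h d'" for d'
    using is_delta_rot_mono[OF that \<open>is_delta h d\<close>] is_delta_rot_mono[OF \<open>is_delta h d\<close> that] by force
  ultimately have ex1: "\<exists>!d. is_delta h d"
    by blast
  then have "is_delta h (delta h)"
    unfolding delta_def by (rule theI')
  then show ?thesis
    using ex1 game_eq_heap_val[OF \<open>h \<in> Q1\<close>] by (simp add: heap_val_def)
qed

end
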